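(* Let $F$ be a field of characteristic $2$ and let $L/F$ be a separable algebraic field extension. Let $\phi,\psi$ be either both totally singular quadratic forms over $F$ or both nonsingular symmetric bilinear forms over $F$. Then $\phi$ and $\psi$ are similar over $F$ if and only if $\phi_L$ and $\psi_L$ are similar over $L$.
   Context: Two forms $\phi,\psi$ over a field $E$ are similar if $\phi\cong c\psi$ for some $c\in E^*$. A totally singular quadratic form is one isometric to $a_1x_1^2+\dots+a_nx_n^2$. *)

theory Defs
  imports "HOL-Computational_Algebra.Polynomial" "HOL-Computational_Algebra.Polynomial_Factorial"
begin

(* The big field L is the type 'a; the base field F is a subfield F \<subseteq> UNIV. *)
definition is_subfield :: "'a::field set \<Rightarrow> bool" where
  "is_subfield K \<longleftrightarrow> 0 \<in> K \<and> 1 \<in> K \<and>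
     (\<forall>x\<in>K. \<forall>y\<in>K. x + y \<in> K \<and> x * y \<in> K) \<and>
     (\<forall>x\<in>K. - x \<in> K \<and> inverse x \<in> K)"

definition separable_over :: "'a::field set \<Rightarrow> 'a \<Rightarrow> bool" where
  "separable_over K x \<longleftrightarrow> (\<exists>p. p \<noteq> 0 \<and> (\<forall>i. coeff p i \<in> K) \<and> poly p x = 0
       \<and> coprime p (pderiv p))"

definition separable_algebraic_ext :: "'a::field set \<Rightarrow> bool" where
  "separable_algebraic_ext K \<longleftrightarrow> is_subfield K \<and> (\<forall>x. separable_over K x)"

definition vec_in :: "'a set \<Rightarrow> nat \<Rightarrow> (nat \<Rightarrow> 'a) \<Rightarrow> bool" where
  "vec_in K n x \<longleftrightarrow> (\<forall>i<n. x i \<in> K)"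

definition mat_in :: "'a set \<Rightarrow> nat \<Rightarrow> (nat \<Rightarrow> nat \<Rightarrow> 'a) \<Rightarrow> bool" where
  "mat_in K n M \<longleftrightarrow> (\<forall>i<n. \<forall>j<n. M i j \<in> K)"

definition matvec :: "nat \<Rightarrow> (nat \<Rightarrow> nat \<Rightarrow> 'a::comm_ring_1) \<Rightarrow> (nat \<Rightarrow> 'a) \<Rightarrow> nat \<Rightarrow> 'a" where
  "matvec n M x = (\<lambda>i. \<Sum>j<n. M i j * x j)"

definition invertible_over :: "'a::comm_ring_1 set \<Rightarrow> nat \<Rightarrow> (nat \<Rightarrow> nat \<Rightarrow> 'a) \<Rightarrow> bool" where
  "invertible_over K n M \<longleftrightarrow> mat_in K n M \<and> (\<exists>N. mat_in K n N \<and>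
     (\<forall>i<n. \<forall>k<n. (\<Sum>j<n. M i j * N j k) = (if i = k then 1 else 0)) \<and>
     (\<forall>i<n. \<forall>k<n. (\<Sum>j<n. N i j * M j k) = (if i = k then 1 else 0)))"

definition qf_eval :: "nat \<Rightarrow> (nat \<Rightarrow> nat \<Rightarrow> 'a::comm_ring_1) \<Rightarrow> (nat \<Rightarrow> 'a) \<Rightarrow> 'a" where
  "qf_eval n c x = (\<Sum>i<n. \<Sum>j\<in>{i..<n}. c i j * x i * x j)"

definition is_qf :: "'a set \<Rightarrow> nat \<Rightarrow> (nat \<Rightarrow> nat \<Rightarrow> 'a) \<Rightarrow> bool" where
  "is_qf K n c \<longleftrightarrow> (\<forall>i j. i \<le> j \<and> j < n \<longrightarrow> c i j \<in> K)"

definition qf_iso :: "'a::comm_ring_1 set \<Rightarrow> nat \<Rightarrow> (nat \<Rightarrow> nat \<Rightarrow> 'a) \<Rightarrow> nat \<Rightarrow> (nat \<Rightarrow> nat \<Rightarrow> 'a) \<Rightarrow> bool" where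
  "qf_iso K m c n d \<longleftrightarrow> m = n \<and> (\<exists>M. invertible_over K n M \<and>
     (\<forall>x. vec_in K n x \<longrightarrow> qf_eval n c (matvec n M x) = qf_eval n d x))"

definition diag_qf :: "(nat \<Rightarrow> 'a::zero) \<Rightarrow> nat \<Rightarrow> nat \<Rightarrow> 'a" where
  "diag_qf a = (\<lambda>i j. if i = j then a i else 0)"

definition totally_singular_qf :: "'a::comm_ring_1 set \<Rightarrow> nat \<Rightarrow> (nat \<Rightarrow> nat \<Rightarrow> 'a) \<Rightarrow> bool" where
  "totally_singular_qf K n c \<longleftrightarrow> is_qf K n c \<and>
     (\<exists>a. vec_in K n a \<and> qf_iso K n c n (diag_qf a))"

definition qf_similar :: "'a::comm_ring_1 set \<Rightarrow> nat \<Rightarrow> (nat \<Rightarrow> nat \<Rightarrow> 'a) \<Rightarrow> nat \<Rightarrow> (nat \<Rightarrow> nat \<Rightarrow> 'a) \<Rightarrow> bool" where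
  "qf_similar K m c n d \<longleftrightarrow> (\<exists>t\<in>K. t \<noteq> 0 \<and> qf_iso K m c n (\<lambda>i j. t * d i j))"

definition bf_eval :: "nat \<Rightarrow> (nat \<Rightarrow> nat \<Rightarrow> 'a::comm_ring_1) \<Rightarrow> (nat \<Rightarrow> 'a) \<Rightarrow> (nat \<Rightarrow> 'a) \<Rightarrow> 'a" where
  "bf_eval n B x y = (\<Sum>i<n. \<Sum>j<n. B i j * x i * y j)"

definition nonsingular_symmetric_bf :: "'a::comm_ring_1 set \<Rightarrow> nat \<Rightarrow> (nat \<Rightarrow> nat \<Rightarrow> 'a) \<Rightarrow> bool" where
  "nonsingular_symmetric_bf K n B \<longleftrightarrow> mat_in K n B \<and>
     (\<forall>i<n. \<forall>j<n. B i j = B j i) \<and>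
     (\<forall>x. vec_in K n x \<and> (\<forall>y. vec_in K n y \<longrightarrow> bf_eval n B x y = 0) \<longrightarrow> (\<forall>i<n. x i = 0))"

definition bf_iso :: "'a::comm_ring_1 set \<Rightarrow> nat \<Rightarrow> (nat \<Rightarrow> nat \<Rightarrow> 'a) \<Rightarrow> nat \<Rightarrow> (nat \<Rightarrow> nat \<Rightarrow> 'a) \<Rightarrow> bool" where
  "bf_iso K m B n C \<longleftrightarrow> m = n \<and> (\<exists>M. invertible_over K n M \<and>
     (\<forall>x y. vec_in K n x \<and> vec_in K n y \<longrightarrow>
        bf_eval n B (matvec n M x) (matvec n M y) = bf_eval n C x y))"

definition bf_similar :: "'a::comm_ring_1 set \<Rightarrow> nat \<Rightarrow> (nat \<Rightarrow> nat \<Rightarrow> 'a) \<Rightarrow> nat \<Rightarrow> (nat \<Rightarrow> nat \<Rightarrow> 'a) \<Rightarrow> bool" where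
  "bf_similar K m B n C \<longleftrightarrow> (\<exists>t\<in>K. t \<noteq> 0 \<and> bf_iso K m B n (\<lambda>i j. t * C i j))"

end

theory Submission
  imports Defs "Jordan_Normal_Form.Determinant" "HOL-Library.Function_Algebras"
begin

text \<open>
  Write \<open>q\<^sub>B(x) = B(x,x)\<close>, which is additive in characteristic 2. A similarity \<open>M\<close> with factor \<open>c\<close>
  over \<open>L\<close> and \<open>M' = c M\<^sup>-\<^sup>1\<close> satisfy \<open>q\<^sub>B(M x) = c q\<^sub>C(x)\<close>, \<open>q\<^sub>C(M' y) = c q\<^sub>B(y)\<close> and
  \<open>B(M x, y) = C(x, M' y)\<close>. The first two conditions are Frobenius-semilinear in the entries of \<open>M\<close>, \<open>M'\<close>
  and linear in \<open>c\<close>, the third one is linear. Since \<open>L/F\<close> is separable, \<open>F\<close>-linearly independent elements of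
  \<open>L\<close> have \<open>F\<close>-linearly independent squares and \<open>L = F L\<^sup>2\<close>, so there are \<open>F\<close>-linear functionals
  \<open>lam, mu\<close> with \<open>mu(u\<^sup>2) = lam(u)\<^sup>2\<close> and \<open>mu(c) \<noteq> 0\<close>. Applying \<open>lam\<close> to \<open>M\<close>, \<open>M'\<close> and \<open>mu\<close> to \<open>c\<close>
  yields a solution of the three conditions over \<open>F\<close>, in general with singular matrices.

  Such a solution already forces the forms to be similar over \<open>F\<close>: on the orthogonal complement of the isotropic
  vectors the matrix over \<open>F\<close> is a similarity, and by a Witt type argument a maximal partial similarity extending it
  is defined everywhere. Totally singular quadratic forms are treated alike, without the third condition.
\<close>

section \<open>Separable extensions in characteristic 2\<close>

text \<open>That \<open>M\<close> and \<open>M'\<close> are inverse up to a scalar is a condition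
  bilinear in their entries, so no linear functional transports it. The adjoint relation takes its
  place: it is linear in the pair, and it keeps the part of the forms that norms
  \<open>B(x,x)\<close> do not see (for an alternating form they all vanish). The price is that
  invertibility must be rebuilt over \<open>F\<close>. An unrestricted Witt extension would fail
  there, since in characteristic 2 a partial isometry between subspaces need not extend. The remedy:
  vectors of norm zero form a subspace, isometries are rigid on its orthogonal complement, and every
  vector orthogonal to that complement again has norm zero. Once the map is fixed on the complement,
  the norm condition can be met in every later extension. The factor obtained over \<open>F\<close>
  is \<open>mu(c)\<close>, not \<open>c\<close>, which need not lie in \<open>F\<close>. The
  functionals live on the algebra generated by the finitely many entries involved: finite dimension
  is what turns "the squares of a basis span" into "the squares of a basis form a basis".\<close>

lemma subfieldD:
  assumes "is_subfield K"
  shows "0 \<in> K" "1 \<in> K" "x \<in> K \<Longrightarrow> y \<in> K \<Longrightarrow> x + y \<in> K" "x \<in> K \<Longrightarrow> y \<in> K \<Longrightarrow> x * y \<in> K"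
    "x \<in> K \<Longrightarrow> - x \<in> K" "x \<in> K \<Longrightarrow> inverse x \<in> K"
  using assms unfolding is_subfield_def by auto

lemma subfield_diff: "is_subfield K \<Longrightarrow> x \<in> K \<Longrightarrow> y \<in> K \<Longrightarrow> x - y \<in> K"
  using subfieldD(3)[of K x "- y"] subfieldD(5)[of K y] by simp

lemma subfield_divide: "is_subfield K \<Longrightarrow> x \<in> K \<Longrightarrow> y \<in> K \<Longrightarrow> x / y \<in> K"
  by (simp add: divide_inverse subfieldD)

lemma subfield_sum: "is_subfield K \<Longrightarrow> (\<And>i. i \<in> A \<Longrightarrow> f i \<in> K) \<Longrightarrow> sum f A \<in> K"
  by (induction A rule: infinite_finite_induct) (auto simp: subfieldD)

lemma subfield_power: "is_subfield K \<Longrightarrow> x \<in> K \<Longrightarrow> x ^ k \<in> K"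
  by (induction k) (auto simp: subfieldD)

lemma subfield_of_nat: "is_subfield K \<Longrightarrow> of_nat k \<in> K"
  by (induction k) (auto simp: subfieldD)

section \<open>Linear spans and finitely generated algebras over a subfield\<close>

inductive_set fspan :: "'a::field set \<Rightarrow> 'a set \<Rightarrow> 'a set" for K T where
  fspan_0: "0 \<in> fspan K T"
| fspan_step: "a \<in> K \<Longrightarrow> t \<in> T \<Longrightarrow> u \<in> fspan K T \<Longrightarrow> a * t + u \<in> fspan K T"

lemma fspan_add: "u \<in> fspan K T \<Longrightarrow> v \<in> fspan K T \<Longrightarrow> u + v \<in> fspan K T"
  by (induction rule: fspan.induct) (auto simp: add.assoc intro: fspan.intros)

lemma fspan_scale:
  assumes "is_subfield K" "a \<in> K" "u \<in> fspan K T"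
  shows "a * u \<in> fspan K T"
  using assms(3)
proof (induction rule: fspan.induct)
  case (fspan_step b t u)
  then have "(a * b) * t + a * u \<in> fspan K T"
    using assms by (intro fspan.intros) (auto simp: subfieldD)
  then show ?case by (simp add: algebra_simps)
qed (auto intro: fspan.intros)

lemma fspan_base: "is_subfield K \<Longrightarrow> t \<in> T \<Longrightarrow> t \<in> fspan K T"
  using fspan_step[of 1 K t T 0] by (auto simp: subfieldD fspan_0)

lemma fspan_sum: "(\<And>i. i \<in> A \<Longrightarrow> f i \<in> fspan K T) \<Longrightarrow> sum f A \<in> fspan K T"
  by (induction A rule: infinite_finite_induct) (auto intro: fspan_add fspan_0)

lemma fspan_trans:
  assumes "is_subfield K" "T \<subseteq> fspan K T'" "u \<in> fspan K T"
  shows "u \<in> fspan K T'"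
  using assms(3)
  by (induction rule: fspan.induct) (use assms in \<open>auto intro!: fspan_0 fspan_add fspan_scale\<close>)

lemma fspan_mult:
  assumes "is_subfield K" "u \<in> fspan K T" "v \<in> fspan K T'"
  shows "u * v \<in> fspan K {t * t' | t t'. t \<in> T \<and> t' \<in> T'}"
  using assms(2)
proof (induction rule: fspan.induct)
  case (fspan_step a t u)
  have "t * v \<in> fspan K {t * t' | t t'. t \<in> T \<and> t' \<in> T'}"
    using assms(3)
  proof (induction rule: fspan.induct)
    case (fspan_step b s w)
    have "b * (t * s) + t * w \<in> fspan K {t * t' | t t'. t \<in> T \<and> t' \<in> T'}"
      using fspan_step \<open>t \<in> T\<close> by (intro fspan.intros) auto
    then show ?case by (simp add: algebra_simps)
  qed (simp add: fspan_0)
  then have "a * (t * v) + u * v \<in> fspan K {t * t' | t t'. t \<in> T \<and> t' \<in> T'}"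
    using fspan_step fspan_scale[OF assms(1)] by (auto intro: fspan_add)
  then show ?case by (simp add: algebra_simps)
qed (simp add: fspan_0)

lemma fspan_eq_sum:
  assumes "is_subfield K" "finite T" "u \<in> fspan K T"
  shows "\<exists>a. (\<forall>t. a t \<in> K) \<and> u = (\<Sum>t\<in>T. a t * t)"
  using assms(3)
proof (induction rule: fspan.induct)
  case fspan_0
  then show ?case using assms by (intro exI[of _ "\<lambda>_. 0"]) (auto simp: subfieldD)
next
  case (fspan_step b s u)
  then obtain a where a: "\<forall>t. a t \<in> K" "u = (\<Sum>t\<in>T. a t * t)" by auto
  have "(\<Sum>t\<in>T. (if t = s then b else 0) * t) = (\<Sum>t\<in>T. if t = s then b * t else 0)"
    by (intro sum.cong) auto
  then have "b * s = (\<Sum>t\<in>T. (if t = s then b else 0) * t)" using assms(2) fspan_step by simp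
  then have "b * s + u = (\<Sum>t\<in>T. (a t + (if t = s then b else 0)) * t)"
    using a by (simp add: sum.distrib distrib_right)
  then show ?case
    using a fspan_step assms
    by (intro exI[of _ "\<lambda>t. a t + (if t = s then b else 0)"]) (auto simp: subfieldD)
qed

inductive_set alg_gen :: "'a::field set \<Rightarrow> 'a set \<Rightarrow> 'a set" for K S where
  alg_base: "a \<in> K \<Longrightarrow> a \<in> alg_gen K S"
| alg_gen: "a \<in> S \<Longrightarrow> a \<in> alg_gen K S"
| alg_add: "a \<in> alg_gen K S \<Longrightarrow> b \<in> alg_gen K S \<Longrightarrow> a + b \<in> alg_gen K S"
| alg_mult: "a \<in> alg_gen K S \<Longrightarrow> b \<in> alg_gen K S \<Longrightarrow> a * b \<in> alg_gen K S"

lemma alg_gen_power: "is_subfield K \<Longrightarrow> a \<in> alg_gen K S \<Longrightarrow> a ^ k \<in> alg_gen K S"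
  by (induction k) (auto intro: alg_gen.intros simp: subfieldD)

text \<open>The equation \<open>p\<close>, divided by its leading coefficient, rewrites
  \<open>x ^ degree p\<close> through lower powers; hence multiplication by \<open>x\<close>
  preserves the span of the lower powers.\<close>

lemma power_in_fspan_lower:
  assumes K: "is_subfield K" and p: "p \<noteq> 0" "\<forall>i. coeff p i \<in> K" "poly p x = 0"
  shows "x ^ k \<in> fspan K ((\<lambda>j. x ^ j) ` {..<degree p})"
proof (induction k)
  let ?T = "(\<lambda>j. x ^ j) ` {..<degree p}"
  \<comment> \<open>A nonzero constant has no root, so \<open>x ^ 0\<close> is among the listed
    powers.\<close>
  have deg: "degree p > 0"
  proof (rule ccontr)
    assume "\<not> degree p > 0"
    then obtain a where "p = [:a:]" by (metis degree_eq_zeroE neq0_conv)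
    then show False using p by auto
  qed
  case 0
  have "x ^ 0 \<in> ?T" using deg by blast
  then show ?case by (rule fspan_base[OF K])
next
  let ?T = "(\<lambda>j. x ^ j) ` {..<degree p}"
  case (Suc k)
  have lead: "lead_coeff p \<noteq> 0" using p by simp
  have "x ^ degree p = (\<Sum>i<degree p. (- coeff p i / lead_coeff p) * x ^ i)"
  proof -
    have "0 = (\<Sum>i<degree p. coeff p i * x ^ i) + lead_coeff p * x ^ degree p"
      using p(3) unfolding poly_altdef by (simp add: lessThan_Suc_atMost[symmetric])
    then have "lead_coeff p * x ^ degree p = - (\<Sum>i<degree p. coeff p i * x ^ i)"
      by (metis add_eq_0_iff)
    then have "x ^ degree p = - (\<Sum>i<degree p. coeff p i * x ^ i) / lead_coeff p"
      using lead by (simp add: field_simps)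
    then show ?thesis by (simp add: sum_divide_distrib sum_negf)
  qed
  also have "\<dots> \<in> fspan K ?T"
  proof (rule fspan_sum)
    fix i assume "i \<in> {..<degree p}"
    then show "- coeff p i / lead_coeff p * x ^ i \<in> fspan K ?T"
      using K p(2) by (intro fspan_scale[OF K] fspan_base[OF K])
        (auto intro!: subfield_divide subfieldD(5))
  qed
  finally have top: "x ^ degree p \<in> fspan K ?T" .
  have step: "x * u \<in> fspan K ?T" if "u \<in> fspan K ?T" for u
    using that
  proof (induction rule: fspan.induct)
    case (fspan_step a t u)
    then obtain j where j: "j < degree p" "t = x ^ j" by auto
    have "x * t \<in> fspan K ?T"
    proof (cases "Suc j < degree p")
      case True
      then have "x ^ Suc j \<in> ?T" by blast
      then show ?thesis using fspan_base[OF K] j by auto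
    next
      case False
      then have "Suc j = degree p" using j by auto
      then show ?thesis using top j by (metis power_Suc)
    qed
    then have "a * (x * t) + x * u \<in> fspan K ?T"
      using fspan_step by (intro fspan_add fspan_scale[OF K, of a]) auto
    then show ?case by (simp add: algebra_simps)
  qed (simp add: fspan_0)
  show ?case using step[OF Suc] by simp
qed

text \<open>One algebraic generator is adjoined at a time: a finite spanning set, multiplied by the
  powers of \<open>x\<close> below the degree of an equation for \<open>x\<close>, spans the larger
  algebra.\<close>

lemma alg_gen_finite_span:
  assumes K: "is_subfield K" and alg: "\<And>x. \<exists>p. p \<noteq> 0 \<and> (\<forall>i. coeff p i \<in> K) \<and> poly p x = 0"
    and "finite S"
  shows "\<exists>T. finite T \<and> T \<subseteq> alg_gen K S \<and> alg_gen K S \<subseteq> fspan K T"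
  using assms(3)
proof (induction S rule: finite_induct)
  case empty
  have "u \<in> fspan K {1}" if "u \<in> alg_gen K {}" for u
  proof -
    have "u \<in> K" using that by (induction rule: alg_gen.induct) (use K in \<open>auto simp: subfieldD\<close>)
    then show ?thesis using fspan_step[of u K 1 "{1}" 0] by (auto simp: fspan_0)
  qed
  then show ?case using K by (intro exI[of _ "{1}"]) (auto intro: alg_gen.intros simp: subfieldD)
next
  case (insert x S)
  then obtain T where T: "finite T" "T \<subseteq> alg_gen K S" "alg_gen K S \<subseteq> fspan K T" by auto
  obtain p where p: "p \<noteq> 0" "\<forall>i. coeff p i \<in> K" "poly p x = 0" using alg by blast
  let ?X = "(\<lambda>j. x ^ j) ` {..<degree p}"
  let ?T = "{t * t' | t t'. t \<in> T \<and> t' \<in> ?X}"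
  \<comment> \<open>Closed under products, so its span is a ring containing the generators.\<close>
  let ?Z = "{a * x ^ k | a k. a \<in> alg_gen K S}"
  have mono: "a \<in> alg_gen K (insert x S)" if "a \<in> alg_gen K S" for a
    using that by (induction rule: alg_gen.induct) (auto intro: alg_gen.intros)
  have ZT: "?Z \<subseteq> fspan K ?T"
  proof
    fix u assume "u \<in> ?Z"
    then obtain a k where u: "u = a * x ^ k" "a \<in> fspan K T" using T(3) by auto
    show "u \<in> fspan K ?T"
      unfolding u(1) by (rule fspan_mult[OF K u(2) power_in_fspan_lower[OF K p]])
  qed
  have ZZ: "{t * t' | t t'. t \<in> ?Z \<and> t' \<in> ?Z} \<subseteq> ?Z"
  proof clarify
    fix a k b l assume "a \<in> alg_gen K S" "b \<in> alg_gen K S"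
    then show "\<exists>a' k'. a * x ^ k * (b * x ^ l) = a' * x ^ k' \<and> a' \<in> alg_gen K S"
      by (intro exI[of _ "a * b"] exI[of _ "k + l"]) (auto simp: power_add alg_mult)
  qed
  have "u \<in> fspan K ?Z" if "u \<in> alg_gen K (insert x S)" for u
    using that
  proof (induction rule: alg_gen.induct)
    case (alg_base a)
    then have "a = a * x ^ 0" "a \<in> alg_gen K S" by (auto intro: alg_gen.intros)
    then have "a \<in> ?Z" by blast
    then show ?case by (rule fspan_base[OF K])
  next
    case (alg_gen a)
    show ?case
    proof (cases "a = x")
      case True
      have "x = 1 * x ^ 1" "1 \<in> alg_gen K S" using K by (auto intro: alg_gen.intros simp: subfieldD)
      then have "x \<in> ?Z" by blast
      then show ?thesis unfolding True by (rule fspan_base[OF K])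
    next
      case False
      then have "a = a * x ^ 0" "a \<in> alg_gen K S" using alg_gen by (auto intro: alg_gen.intros)
      then have "a \<in> ?Z" by blast
      then show ?thesis by (rule fspan_base[OF K])
    qed
  next
    case (alg_add a b)
    then show ?case by (auto intro: fspan_add)
  next
    case (alg_mult a b)
    show ?case
    proof (rule fspan_trans[OF K _ fspan_mult[OF K alg_mult.IH]])
      show "{t * t' | t t'. t \<in> ?Z \<and> t' \<in> ?Z} \<subseteq> fspan K ?Z"
        by (rule subset_trans[OF ZZ]) (rule subsetI, rule fspan_base[OF K])
    qed
  qed
  then have "alg_gen K (insert x S) \<subseteq> fspan K ?T" by (intro subsetI fspan_trans[OF K ZT])
  moreover have "finite ?T" using T by (simp add: finite_image_set2)
  moreover have "?T \<subseteq> alg_gen K (insert x S)"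
  proof clarify
    fix t j assume "t \<in> T"
    then show "t * x ^ j \<in> alg_gen K (insert x S)"
      using mono T(2) K by (intro alg_mult[OF _ alg_gen_power]) (auto intro: alg_gen.alg_gen)
  qed
  ultimately show ?case by blast
qed

text \<open>A spanning set of least cardinality is independent: a nontrivial relation would express
  one of its elements by the others.\<close>

lemma finite_span_imp_basis:
  assumes K: "is_subfield K" and "finite T" "T \<subseteq> A" "A \<subseteq> fspan K T"
  shows "\<exists>T. finite T \<and> T \<subseteq> A \<and> A \<subseteq> fspan K T \<and>
    (\<forall>a. (\<forall>t\<in>T. a t \<in> K) \<and> (\<Sum>t\<in>T. a t * t) = 0 \<longrightarrow> (\<forall>t\<in>T. a t = 0))"
proof -
  let ?P = "\<lambda>T. finite T \<and> T \<subseteq> A \<and> A \<subseteq> fspan K T"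
  have "?P T" using assms by auto
  from ex_has_least_nat[of ?P, OF this, of card]
  obtain T where T: "?P T" and min: "\<And>T'. ?P T' \<Longrightarrow> card T \<le> card T'"
    by blast
  have "a s = 0" if a: "\<forall>t\<in>T. a t \<in> K" "(\<Sum>t\<in>T. a t * t) = 0" and s: "s \<in> T" for a s
  proof (rule ccontr)
    assume nz: "a s \<noteq> 0"
    let ?T = "T - {s}"
    have "a s * s + (\<Sum>t\<in>?T. a t * t) = 0"
      using a T s by (simp add: sum.remove)
    then have "a s * s = - (\<Sum>t\<in>?T. a t * t)" by (metis add_eq_0_iff2)
    then have "s = - (\<Sum>t\<in>?T. a t * t) / a s"
      using nz by (simp add: field_simps)
    then have "s = (\<Sum>t\<in>?T. (- a t / a s) * t)"
      by (simp add: sum_divide_distrib sum_negf)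
    also have "\<dots> \<in> fspan K ?T"
    proof (rule fspan_sum)
      fix t assume "t \<in> ?T"
      then show "- a t / a s * t \<in> fspan K ?T"
        using a(1) s K by (intro fspan_scale[OF K] fspan_base[OF K])
          (auto intro!: subfield_divide subfieldD(5))
    qed
    finally have "s \<in> fspan K ?T" .
    then have TT: "T \<subseteq> fspan K ?T" using fspan_base[OF K, of _ ?T] by auto
    have "A \<subseteq> fspan K ?T" using fspan_trans[OF K TT] T by auto
    then have "card T \<le> card ?T" using T by (intro min) auto
    moreover have "card ?T < card T" using T s by (meson card_Diff1_less)
    ultimately show False by simp
  qed
  then show ?thesis using T by blast
qed

section \<open>Subrings containing the square of a separable element\<close>

lemma sum_in_additive_set:
  assumes "0 \<in> A" "\<And>a b. a \<in> A \<Longrightarrow> b \<in> A \<Longrightarrow> a + b \<in> A" "\<And>i. i \<in> I \<Longrightarrow> f i \<in> A"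
  shows "sum f I \<in> A"
  using assms(3) by (induction I rule: infinite_finite_induct) (auto intro: assms(1,2))

text \<open>An equation with nonzero constant term \<open>c\<close> reads \<open>u * v = - c\<close>
  with \<open>v\<close> a polynomial in \<open>u\<close>. A vanishing constant term is removed by
  cancelling \<open>u\<close>, which lowers the degree.\<close>

lemma inverse_in_subring:
  assumes K: "is_subfield K" and alg: "\<exists>p. p \<noteq> 0 \<and> (\<forall>i. coeff p i \<in> K) \<and> poly p u = 0"
    and A: "K \<subseteq> A" "\<And>a b. a \<in> A \<Longrightarrow> b \<in> A \<Longrightarrow> a + b \<in> A" "\<And>a b. a \<in> A \<Longrightarrow> b \<in> A \<Longrightarrow> a * b \<in> A"
    and u: "u \<in> A" "u \<noteq> 0"
  shows "inverse u \<in> A"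
proof -
  have main: "inverse u \<in> A" if "p \<noteq> 0" "\<forall>i. coeff p i \<in> K" "poly p u = 0" for p
    using that
  proof (induction p)
    case (pCons c p)
    have cf: "\<forall>i. coeff p i \<in> K" "c \<in> K"
      using pCons.prems(2) by (metis coeff_pCons_Suc, metis coeff_pCons_0)
    have pow: "u ^ k \<in> A" for k
      using A(1) A(3) u subfieldD(2)[OF K] by (induction k) auto
    have polyA: "poly p u \<in> A"
    proof -
      have "0 \<in> A" "coeff p i \<in> A" for i using cf A(1) subfieldD(1)[OF K] by auto
      then show ?thesis unfolding poly_altdef by (intro sum_in_additive_set A(2,3) pow)
    qed
    have eq: "c + u * poly p u = 0" using pCons.prems(3) by simp
    show ?case
    proof (cases "c = 0")
      case True
      then show ?thesis using eq u cf pCons by auto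
    next
      case False
      have "u * poly p u = - c" using eq by (metis add_eq_0_iff)
      then have "u * (poly p u * inverse (- c)) = 1"
        using False by (metis mult.assoc neg_equal_0_iff_equal right_inverse)
      then have "inverse u = poly p u * inverse (- c)" by (rule inverse_unique)
      moreover have "inverse (- c) \<in> A" using cf(2) A(1) K subfieldD(5,6) by blast
      ultimately show ?thesis using A(3)[OF polyA] by metis
    qed
  qed simp
  show ?thesis using alg main by blast
qed

text \<open>Only even exponents occur, so the value is a polynomial in \<open>x ^ 2\<close>.\<close>

lemma poly_even_in_subring:
  assumes K: "is_subfield K" and h: "\<forall>i. coeff h i \<in> K" "\<And>i. odd i \<Longrightarrow> coeff h i = 0"
    and A: "K \<subseteq> A" "\<And>a b. a \<in> A \<Longrightarrow> b \<in> A \<Longrightarrow> a + b \<in> A" "\<And>a b. a \<in> A \<Longrightarrow> b \<in> A \<Longrightarrow> a * b \<in> A"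
    and x: "x ^ 2 \<in> A"
  shows "poly h x \<in> A"
proof -
  have pow: "(x ^ 2) ^ k \<in> A" for k
    using A(1) A(3) x subfieldD(2)[OF K] by (induction k) auto
  have zero: "0 \<in> A" using A(1) subfieldD(1)[OF K] by auto
  have mon: "coeff h i * x ^ i \<in> A" for i
  proof (cases "even i")
    case True
    then obtain k where "i = 2 * k" by auto
    moreover have "coeff h i \<in> A" using h(1) A(1) by auto
    ultimately show ?thesis using pow[of k] A(3) by (simp add: power_mult)
  next
    case False
    then show ?thesis using h(2) zero by simp
  qed
  show ?thesis unfolding poly_altdef by (intro sum_in_additive_set A(2) mon zero)
qed

text \<open>A separable \<open>x\<close> lies in \<open>K(x\<^sup>2)\<close>: with \<open>p = p\<^sub>0(X\<^sup>2) + X p\<^sub>1(X\<^sup>2)\<close> the derivative of \<open>p\<close> is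
  \<open>p\<^sub>1(X\<^sup>2)\<close>, which does not vanish at \<open>x\<close>.\<close>

lemma separable_in_subring:
  fixes K :: "'a::field set"
  assumes char: "CHAR('a) = 2" and sep: "separable_algebraic_ext K"
    and A: "K \<subseteq> A" "\<And>a b. a \<in> A \<Longrightarrow> b \<in> A \<Longrightarrow> a + b \<in> A" "\<And>a b. a \<in> A \<Longrightarrow> b \<in> A \<Longrightarrow> a * b \<in> A"
    and x: "x ^ 2 \<in> A"
  shows "x \<in> A"
proof -
  have K: "is_subfield K" and "separable_over K x" using sep by (auto simp: separable_algebraic_ext_def)
  then obtain p where p: "p \<noteq> 0" "\<forall>i. coeff p i \<in> K" "poly p x = 0" "coprime p (pderiv p)"
    unfolding separable_over_def by auto
  let ?d = "poly (pderiv p) x"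
  have nz: "?d \<noteq> 0"
  proof
    assume "?d = 0"
    then have "[:- x, 1:] dvd pderiv p" "[:- x, 1:] dvd p" using p by (auto simp: poly_eq_0_iff_dvd)
    then have "is_unit [:- x, 1:]" using p(4) coprime_common_divisor by blast
    then show False by (simp add: is_unit_pCons_iff)
  qed
  have of_nat_even: "(of_nat i :: 'a) = 0" if "even i" for i
    using that char of_nat_eq_0_iff_char_dvd[where 'a='a] by auto
  have of_nat_odd: "(of_nat i :: 'a) = 1" if "odd i" for i
    using that of_nat_even[of "i - 1"] by (cases i) auto
  \<comment> \<open>The coefficient \<open>of_nat (Suc i) * coeff p (Suc i)\<close> of the
    derivative vanishes for odd \<open>i\<close> in characteristic 2.\<close>
  have dA: "?d \<in> A"
  proof (rule poly_even_in_subring[OF K _ _ A x])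
    show "\<forall>i. coeff (pderiv p) i \<in> K"
      using p K by (auto simp: coeff_pderiv intro!: subfieldD(4) subfield_of_nat simp del: of_nat_Suc)
    show "coeff (pderiv p) i = 0" if "odd i" for i
      using of_nat_even[of "Suc i"] that by (simp add: coeff_pderiv del: of_nat_Suc)
  qed
  \<comment> \<open>Up to sign this polynomial is the even part of \<open>p\<close>, with
    coefficients \<open>(of_nat i - 1) * coeff p i\<close>. As \<open>p\<close> vanishes at
    \<open>x\<close>, its value there is \<open>x * ?d\<close>.\<close>
  have qA: "poly (pCons 0 (pderiv p) - p) x \<in> A"
  proof (rule poly_even_in_subring[OF K _ _ A x])
    have c: "coeff (pCons 0 (pderiv p) - p) i = (of_nat i - 1) * coeff p i" for i
      by (cases i) (auto simp: coeff_pderiv algebra_simps)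
    show "\<forall>i. coeff (pCons 0 (pderiv p) - p) i \<in> K"
      unfolding c using p K by (auto intro!: subfieldD(4) subfield_diff subfield_of_nat subfieldD(2))
    show "coeff (pCons 0 (pderiv p) - p) i = 0" if "odd i" for i
      unfolding c using of_nat_odd[OF that] by simp
  qed
  have "inverse ?d \<in> A"
    by (rule inverse_in_subring[OF K _ A dA nz])
      (use sep in \<open>auto simp: separable_algebraic_ext_def separable_over_def\<close>)
  moreover have "x * ?d \<in> A" using qA p by simp
  ultimately have "(x * ?d) * inverse ?d \<in> A" using A(3) by blast
  then show ?thesis using nz by (simp add: mult.assoc)
qed

lemma left_inverse_imp_right_inverse:
  fixes Z X :: "nat \<Rightarrow> nat \<Rightarrow> 'a::field"
  assumes "\<forall>i<n. \<forall>k<n. (\<Sum>j<n. Z i j * X j k) = (if i = k then 1 else 0)"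
  shows "\<forall>i<n. \<forall>k<n. (\<Sum>j<n. X i j * Z j k) = (if i = k then 1 else 0)"
proof -
  let ?Z = "mat n n (\<lambda>(i, j). Z i j)" and ?X = "mat n n (\<lambda>(i, j). X i j)"
  have prod: "mat n n (\<lambda>(i, j). P i j) * mat n n (\<lambda>(i, j). Q i j) = mat n n (\<lambda>(i, k). \<Sum>j<n. P i j * Q j k)"
    for P Q :: "nat \<Rightarrow> nat \<Rightarrow> 'a"
    by (rule eq_matI) (auto simp: scalar_prod_def atLeast0LessThan)
  have "?Z * ?X = 1\<^sub>m n" unfolding prod using assms by (intro eq_matI) auto
  then have "?X * ?Z = 1\<^sub>m n" by (rule mat_mult_left_right_inverse[OF mat_carrier mat_carrier])
  then have eq: "mat n n (\<lambda>(i, k). \<Sum>j<n. X i j * Z j k) = 1\<^sub>m n" unfolding prod .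
  show ?thesis
  proof (intro allI impI)
    fix i k assume "i < n" "k < n"
    then show "(\<Sum>j<n. X i j * Z j k) = (if i = k then 1 else 0)"
      using arg_cong[OF eq, of "\<lambda>m. m $$ (i, k)"] by simp
  qed
qed

section \<open>Coordinates and functionals compatible with squaring\<close>

lemma basis_coordinate_linear:
  assumes K: "is_subfield K"
    and indep: "\<forall>a. (\<forall>i<r. a i \<in> K) \<longrightarrow> (\<Sum>i<r. a i * l i) = 0 \<longrightarrow> (\<forall>i<r. a i = 0)"
    and co: "\<forall>u\<in>A. (\<forall>i. co u i \<in> K) \<and> (\<Sum>i<r. co u i * l i) = u"
    and k: "k < r"
  shows "u \<in> A \<Longrightarrow> (\<forall>i. a i \<in> K) \<Longrightarrow> u = (\<Sum>i<r. a i * l i) \<Longrightarrow> co u k = a k"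
    and "u \<in> A \<Longrightarrow> v \<in> A \<Longrightarrow> u + v \<in> A \<Longrightarrow> co (u + v) k = co u k + co v k"
    and "t \<in> K \<Longrightarrow> u \<in> A \<Longrightarrow> t * u \<in> A \<Longrightarrow> co (t * u) k = t * co u k"
proof -
  show uniq: "co u k = a k" if "u \<in> A" "\<forall>i. a i \<in> K" "u = (\<Sum>i<r. a i * l i)" for u a
  proof -
    have "(\<Sum>i<r. (co u i - a i) * l i) = (\<Sum>i<r. co u i * l i) - (\<Sum>i<r. a i * l i)"
      by (simp add: left_diff_distrib sum_subtractf)
    also have "\<dots> = 0" unfolding that(3)[symmetric] using bspec[OF co that(1)] by simp
    finally have "\<forall>i<r. co u i - a i = 0"
      using bspec[OF co that(1)] that(2) by (intro indep[THEN spec, of "\<lambda>i. co u i - a i", THEN mp, THEN mp]) (auto intro: subfield_diff[OF K])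
    then show ?thesis using k by simp
  qed
  show "co (u + v) k = co u k + co v k" if uv: "u \<in> A" "v \<in> A" "u + v \<in> A"
  proof (rule uniq[OF uv(3)])
    have "(\<Sum>i<r. (co u i + co v i) * l i) = (\<Sum>i<r. co u i * l i) + (\<Sum>i<r. co v i * l i)"
      by (simp add: distrib_right sum.distrib)
    also have "\<dots> = u + v" using bspec[OF co uv(1)] bspec[OF co uv(2)] by simp
    finally show "u + v = (\<Sum>i<r. (co u i + co v i) * l i)" ..
    show "\<forall>i. co u i + co v i \<in> K"
      using bspec[OF co uv(1)] bspec[OF co uv(2)] by (simp add: subfieldD(3)[OF K])
  qed
  show "co (t * u) k = t * co u k" if tu: "t \<in> K" "u \<in> A" "t * u \<in> A"
  proof (rule uniq[OF tu(3)])
    have "(\<Sum>i<r. (t * co u i) * l i) = t * (\<Sum>i<r. co u i * l i)"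
      by (simp add: sum_distrib_left mult.assoc)
    also have "\<dots> = t * u" using bspec[OF co tu(2)] by simp
    finally show "t * u = (\<Sum>i<r. (t * co u i) * l i)" ..
    show "\<forall>i. t * co u i \<in> K"
      using bspec[OF co tu(2)] tu(1) by (simp add: subfieldD(4)[OF K])
  qed
qed

lemma char2_square_add:
  fixes a b :: "'a::field"
  assumes "CHAR('a) = 2"
  shows "(a + b) ^ 2 = a ^ 2 + b ^ 2"
proof -
  have "(2::'a) = 0" using of_nat_CHAR[where 'a='a] assms by simp
  then show ?thesis by (simp add: power2_sum)
qed

lemma char2_square_sum:
  fixes f :: "'b \<Rightarrow> 'a::field"
  assumes "CHAR('a) = 2"
  shows "(sum f I) ^ 2 = (\<Sum>i\<in>I. f i ^ 2)"
  by (induction I rule: infinite_finite_induct) (auto simp: char2_square_add[OF assms])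

lemma char2_add_self:
  fixes a :: "'a::field"
  assumes "CHAR('a) = 2"
  shows "a + a = 0"
proof -
  have "(2::'a) = 0" using of_nat_CHAR[where 'a='a] assms by simp
  then show ?thesis by (metis mult_2 mult_zero_left)
qed

text \<open>The squares of a basis of \<open>A = K[S]\<close> again form a basis: \<open>K\<close>-linear disjointness of \<open>L\<close> and \<open>K\<^sup>1\<^sup>/\<^sup>2\<close>.
  The functionals are the corresponding coordinates with respect to the two bases.\<close>

lemma frobenius_compatible_functionals:
  fixes K :: "'a::field set"
  assumes char: "CHAR('a) = 2" and sep: "separable_algebraic_ext K"
    and S: "finite S" "c \<in> S" "c \<noteq> 0"
  shows "\<exists>A lam mu. S \<subseteq> A \<and> K \<subseteq> A
    \<and> (\<forall>u\<in>A. \<forall>v\<in>A. u + v \<in> A \<and> u * v \<in> A \<and> lam (u + v) = lam u + lam v \<and> mu (u + v) = mu u + mu v)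
    \<and> (\<forall>t\<in>K. \<forall>u\<in>A. lam (t * u) = t * lam u \<and> mu (t * u) = t * mu u)
    \<and> (\<forall>u\<in>A. lam u \<in> K \<and> mu u \<in> K \<and> mu (u ^ 2) = lam u ^ 2) \<and> mu c \<noteq> 0"
proof -
  have K: "is_subfield K" using sep by (simp add: separable_algebraic_ext_def)
  let ?A = "alg_gen K S"
  have KA: "K \<subseteq> ?A" and SA: "S \<subseteq> ?A" by (auto intro: alg_gen.intros)
  have "\<exists>p. p \<noteq> 0 \<and> (\<forall>i. coeff p i \<in> K) \<and> poly p x = 0" for x
    using sep unfolding separable_algebraic_ext_def separable_over_def by blast
  from alg_gen_finite_span[OF K this S(1)]
  obtain T0 where "finite T0" "T0 \<subseteq> ?A" "?A \<subseteq> fspan K T0" by auto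
  from finite_span_imp_basis[OF K this]
  obtain T where T: "finite T" "T \<subseteq> ?A" "?A \<subseteq> fspan K T"
    and indT: "\<And>a. (\<forall>t\<in>T. a t \<in> K) \<Longrightarrow> (\<Sum>t\<in>T. a t * t) = 0 \<Longrightarrow> \<forall>t\<in>T. a t = 0" by blast
  define r where "r = card T"
  obtain l where l: "bij_betw l {..<r} T"
    using ex_bij_betw_nat_finite[OF T(1)] unfolding r_def atLeast0LessThan by blast
  have lA: "l i \<in> ?A" if "i < r" for i using l that T(2) by (auto simp: bij_betw_def)
  have span: "\<exists>a. (\<forall>i. a i \<in> K) \<and> u = (\<Sum>i<r. a i * l i)" if "u \<in> ?A" for u
  proof -
    obtain a where a: "\<forall>t. a t \<in> K" "u = (\<Sum>t\<in>T. a t * t)"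
      using fspan_eq_sum[OF K T(1)] T(3) \<open>u \<in> ?A\<close> by blast
    then have "u = (\<Sum>i<r. a (l i) * l i)" using sum.reindex_bij_betw[OF l, of "\<lambda>t. a t * t"] by simp
    then show ?thesis using a(1) by (intro exI[of _ "\<lambda>i. a (l i)"]) auto
  qed
  have indep: "\<forall>i<r. a i = 0" if "\<forall>i<r. a i \<in> K" "(\<Sum>i<r. a i * l i) = 0" for a
  proof -
    let ?h = "inv_into {..<r} l"
    have h: "?h (l i) = i" if "i < r" for i using l that by (simp add: bij_betw_def inv_into_f_f)
    have hT: "?h t < r" if "t \<in> T" for t
      using inv_into_into[of t l "{..<r}"] l that by (auto simp: bij_betw_def)
    have "(\<Sum>t\<in>T. a (?h t) * t) = (\<Sum>i<r. a (?h (l i)) * l i)"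
      by (rule sum.reindex_bij_betw[OF l, symmetric])
    also have "\<dots> = (\<Sum>i<r. a i * l i)" using h by (intro sum.cong) auto
    finally have "\<forall>t\<in>T. a (?h t) = 0" using that hT by (intro indT) auto
    moreover have "l i \<in> T" if "i < r" for i using l that by (auto simp: bij_betw_def)
    ultimately show ?thesis using h by force
  qed
  \<comment> \<open>The span of all squares is a ring containing \<open>K\<close> and the square of
    each generator, hence by separability each generator and the whole algebra. Additivity of
    squaring then reduces arbitrary squares to those of the \<open>l i\<close>.\<close>
  have square_span: "\<exists>a. (\<forall>i. a i \<in> K) \<and> u = (\<Sum>i<r. a i * l i ^ 2)" if "u \<in> ?A" for u
  proof -
    let ?Q = "{a ^ 2 | a. a \<in> ?A}"
    let ?B = "fspan K ?Q"
    have QQ: "{t * t' | t t'. t \<in> ?Q \<and> t' \<in> ?Q} \<subseteq> ?Q"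
    proof clarify
      fix a b assume "a \<in> ?A" "b \<in> ?A"
      then show "\<exists>c. a ^ 2 * b ^ 2 = c ^ 2 \<and> c \<in> ?A"
        by (intro exI[of _ "a * b"]) (auto simp: power_mult_distrib alg_mult)
    qed
    have mult: "a * b \<in> ?B" if "a \<in> ?B" "b \<in> ?B" for a b
    proof (rule fspan_trans[OF K _ fspan_mult[OF K that]])
      show "{t * t' | t t'. t \<in> ?Q \<and> t' \<in> ?Q} \<subseteq> fspan K ?Q"
        by (rule subset_trans[OF QQ]) (rule subsetI, rule fspan_base[OF K])
    qed
    have "(1::'a) = 1 ^ 2" "1 \<in> ?A" using KA subfieldD(2)[OF K] by auto
    then have "1 \<in> ?Q" by blast
    have KB: "K \<subseteq> ?B"
    proof
      fix a assume "a \<in> K"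
      from fspan_step[OF this \<open>1 \<in> ?Q\<close> fspan_0] show "a \<in> ?B" by simp
    qed
    have "x \<in> ?B" if "x \<in> S" for x
    proof (rule separable_in_subring[OF char sep KB fspan_add mult])
      show "x ^ 2 \<in> ?B" using that SA by (intro fspan_base[OF K]) auto
    qed
    note SB = this
    have "u \<in> ?B" using \<open>u \<in> ?A\<close>
    proof (induction rule: alg_gen.induct)
      case (alg_base a)
      then show ?case using KB by (rule subsetD[rotated])
    next
      case (alg_gen a)
      then show ?case by (rule SB)
    next
      case (alg_add a b)
      show ?case by (rule fspan_add[OF alg_add.IH])
    next
      case (alg_mult a b)
      show ?case by (rule mult[OF alg_mult.IH])
    qed
    then show ?thesis
    proof (induction rule: fspan.induct)
      case fspan_0
      then show ?case using K by (intro exI[of _ "\<lambda>_. 0"]) (auto simp: subfieldD)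
    next
      case (fspan_step b q u)
      from fspan_step.IH obtain a where a: "\<forall>i. a i \<in> K" "u = (\<Sum>i<r. a i * l i ^ 2)" by blast
      from fspan_step.hyps(2) obtain e where e: "e \<in> ?A" "q = e ^ 2" by blast
      from span[OF e(1)] obtain d where d: "\<forall>i. d i \<in> K" "e = (\<Sum>i<r. d i * l i)" by blast
      have "b * q + u = (\<Sum>i<r. (b * d i ^ 2 + a i) * l i ^ 2)"
        unfolding e(2) d(2) a(2) char2_square_sum[OF char]
        by (simp add: sum.distrib distrib_right sum_distrib_left power_mult_distrib mult.assoc)
      moreover have "\<forall>i. b * d i ^ 2 + a i \<in> K"
        using a(1) d(1) fspan_step.hyps(1) by (simp add: subfieldD[OF K] subfield_power[OF K])
      ultimately show ?case by (intro exI[of _ "\<lambda>i. b * d i ^ 2 + a i"] conjI)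
    qed
  qed
  have "\<forall>u\<in>?A. \<exists>a. (\<forall>i. a i \<in> K) \<and> u = (\<Sum>i<r. a i * l i)" by (intro ballI span)
  from bchoice[OF this] obtain co
    where co': "\<forall>u\<in>?A. (\<forall>i. co u i \<in> K) \<and> u = (\<Sum>i<r. co u i * l i)" ..
  have co: "(\<forall>i. co u i \<in> K) \<and> (\<Sum>i<r. co u i * l i) = u" if "u \<in> ?A" for u
    using bspec[OF co' that] by (metis (no_types))
  have "\<forall>u\<in>?A. \<exists>a. (\<forall>i. a i \<in> K) \<and> u = (\<Sum>i<r. a i * l i ^ 2)" by (intro ballI square_span)
  from bchoice[OF this] obtain sq
    where sq': "\<forall>u\<in>?A. (\<forall>i. sq u i \<in> K) \<and> u = (\<Sum>i<r. sq u i * l i ^ 2)" ..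
  have sq: "(\<forall>i. sq u i \<in> K) \<and> (\<Sum>i<r. sq u i * l i ^ 2) = u" if "u \<in> ?A" for u
    using bspec[OF sq' that] by (metis (no_types))
  have l2A: "l i ^ 2 \<in> ?A" if "i < r" for i using lA[OF that] alg_gen_power[OF K] by blast
  \<comment> \<open>Change of basis in both directions: \<open>P\<close> writes the
    \<open>l i\<close> through the squares \<open>l j ^ 2\<close>, and \<open>Q\<close> writes the
    squares through the \<open>l j\<close>.\<close>
  define P where "P = (\<lambda>i. sq (l i))"
  define Q where "Q = (\<lambda>i. co (l i ^ 2))"
  have PK: "P i j \<in> K" if "i < r" for i j using sq[OF lA[OF that]] by (simp add: P_def)
  have QK: "Q i j \<in> K" if "i < r" for i j using co[OF l2A[OF that]] by (simp add: Q_def)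
  have PQ: "\<forall>i<r. \<forall>k<r. (\<Sum>j<r. P i j * Q j k) = (if i = k then 1 else 0)"
  proof (intro allI impI)
    fix i k assume i: "i < r" and k: "k < r"
    have "l i = (\<Sum>j<r. P i j * l j ^ 2)" using sq[OF lA[OF i]] by (simp add: P_def)
    also have "\<dots> = (\<Sum>j<r. P i j * (\<Sum>k<r. Q j k * l k))"
      unfolding Q_def by (intro sum.cong refl) (simp add: co[OF l2A])
    also have "\<dots> = (\<Sum>k<r. (\<Sum>j<r. P i j * Q j k) * l k)"
      unfolding sum_distrib_left sum_distrib_right mult.assoc by (rule sum.swap)
    finally have 1: "l i = (\<Sum>k<r. (\<Sum>j<r. P i j * Q j k) * l k)" .
    have "(\<Sum>k<r. (if i = k then 1 else 0) * l k) = (\<Sum>k<r. if i = k then l k else 0)"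
      by (intro sum.cong) auto
    then have 2: "l i = (\<Sum>k<r. (if i = k then 1 else 0) * l k)" using i by simp
    have "\<forall>k<r. (\<Sum>j<r. P i j * Q j k) - (if i = k then 1 else 0) = 0"
    proof (rule indep)
      show "\<forall>k<r. (\<Sum>j<r. P i j * Q j k) - (if i = k then 1 else 0) \<in> K"
        using i PK QK by (auto intro!: subfield_diff[OF K] subfield_sum[OF K] subfieldD(4)[OF K] simp: subfieldD(1,2)[OF K])
      show "(\<Sum>k<r. ((\<Sum>j<r. P i j * Q j k) - (if i = k then 1 else 0)) * l k) = 0"
        unfolding left_diff_distrib sum_subtractf 1[symmetric] 2[symmetric] by simp
    qed
    then show "(\<Sum>j<r. P i j * Q j k) = (if i = k then 1 else 0)" using k by simp
  qed
  note QP = left_inverse_imp_right_inverse[OF PQ]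
  \<comment> \<open>A relation \<open>a\<close> among the squares gives \<open>a * Q = 0\<close> by
    independence of the \<open>l i\<close>, hence \<open>a = a * Q * P = 0\<close>.\<close>
  have indep2: "\<forall>i<r. a i = 0" if a: "\<forall>i<r. a i \<in> K" "(\<Sum>i<r. a i * l i ^ 2) = 0" for a
  proof -
    have "(\<Sum>k<r. (\<Sum>j<r. a j * Q j k) * l k) = (\<Sum>j<r. a j * (\<Sum>k<r. Q j k * l k))"
      unfolding sum_distrib_left sum_distrib_right mult.assoc by (rule sum.swap)
    also have "\<dots> = (\<Sum>j<r. a j * l j ^ 2)"
      unfolding Q_def by (intro sum.cong refl) (simp add: co[OF l2A])
    finally have e: "(\<Sum>k<r. (\<Sum>j<r. a j * Q j k) * l k) = 0" unfolding a(2) .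
    have "\<forall>k<r. (\<Sum>j<r. a j * Q j k) \<in> K"
      using a(1) QK by (auto intro!: subfield_sum[OF K] subfieldD(4)[OF K])
    from indep[OF this e] have "\<forall>k<r. (\<Sum>j<r. a j * Q j k) = 0" .
    then have z: "(\<Sum>k<r. (\<Sum>j<r. a j * Q j k) * P k i) = 0" for i by simp
    show ?thesis
    proof (intro allI impI)
      fix i assume i: "i < r"
      have "(\<Sum>k<r. (\<Sum>j<r. a j * Q j k) * P k i) = (\<Sum>j<r. a j * (\<Sum>k<r. Q j k * P k i))"
        unfolding sum_distrib_left sum_distrib_right mult.assoc by (rule sum.swap)
      also have "\<dots> = (\<Sum>j<r. if j = i then a j else 0)" using QP i by (intro sum.cong) auto
      also have "\<dots> = a i" using i by simp
      finally show "a i = 0" using z by simp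
    qed
  qed
  \<comment> \<open>This index fixes both functionals: they are the \<open>k\<close>-th coordinates,
    so \<open>mu c\<close> is the nonzero value \<open>sq c k\<close>.\<close>
  obtain k where k: "k < r" "sq c k \<noteq> 0"
  proof -
    have "\<not> (\<forall>k<r. sq c k = 0)"
    proof
      assume "\<forall>k<r. sq c k = 0"
      then have "(\<Sum>i<r. sq c i * l i ^ 2) = 0" by (intro sum.neutral) auto
      moreover have "c \<in> ?A" using SA S(2) by (rule subsetD)
      ultimately show False using S(3) sq[of c] by metis
    qed
    then show ?thesis using that by blast
  qed
  have ind: "\<forall>a. (\<forall>i<r. a i \<in> K) \<longrightarrow> (\<Sum>i<r. a i * l i) = 0 \<longrightarrow> (\<forall>i<r. a i = 0)"
  proof (rule allI, rule impI, rule impI)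
    fix a assume "\<forall>i<r. a i \<in> K" "(\<Sum>i<r. a i * l i) = 0"
    then show "\<forall>i<r. a i = 0" by (rule indep)
  qed
  have "\<forall>u\<in>?A. (\<forall>i. co u i \<in> K) \<and> (\<Sum>i<r. co u i * l i) = u"
    by (intro ballI co)
  note lin = basis_coordinate_linear[OF K ind this k(1)]
  have ind2: "\<forall>a. (\<forall>i<r. a i \<in> K) \<longrightarrow> (\<Sum>i<r. a i * l i ^ 2) = 0 \<longrightarrow> (\<forall>i<r. a i = 0)"
  proof (rule allI, rule impI, rule impI)
    fix a assume "\<forall>i<r. a i \<in> K" "(\<Sum>i<r. a i * l i ^ 2) = 0"
    then show "\<forall>i<r. a i = 0" by (rule indep2)
  qed
  have "\<forall>u\<in>?A. (\<forall>i. sq u i \<in> K) \<and> (\<Sum>i<r. sq u i * l i ^ 2) = u"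
    by (intro ballI sq)
  note sqlin = basis_coordinate_linear[OF K ind2 this k(1)]
  \<comment> \<open>Squaring is additive, so squaring the expansion of \<open>u\<close> in the
    \<open>l i\<close> yields the expansion of \<open>u ^ 2\<close> in the
    \<open>l i ^ 2\<close>.\<close>
  have frob: "sq (u ^ 2) k = co u k ^ 2" if "u \<in> ?A" for u
  proof (rule sqlin(1))
    show "u ^ 2 \<in> ?A" using alg_gen_power[OF K that] .
    have "(\<Sum>i<r. co u i ^ 2 * l i ^ 2) = (\<Sum>i<r. co u i * l i) ^ 2"
      by (simp add: char2_square_sum[OF char] power_mult_distrib)
    also have "\<dots> = u ^ 2" using co[OF that] by simp
    finally show "u ^ 2 = (\<Sum>i<r. co u i ^ 2 * l i ^ 2)" ..
    show "\<forall>i. co u i ^ 2 \<in> K" using co[OF that] K by (auto simp: subfield_power)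
  qed
  have add: "\<forall>u\<in>?A. \<forall>v\<in>?A. u + v \<in> ?A \<and> u * v \<in> ?A
      \<and> co (u + v) k = co u k + co v k \<and> sq (u + v) k = sq u k + sq v k"
  proof (intro ballI)
    fix u v assume u: "u \<in> ?A" "v \<in> ?A"
    have uv: "u + v \<in> ?A" using u by (rule alg_add)
    moreover have "u * v \<in> ?A" using u by (rule alg_mult)
    ultimately show "u + v \<in> ?A \<and> u * v \<in> ?A
        \<and> co (u + v) k = co u k + co v k \<and> sq (u + v) k = sq u k + sq v k"
      using lin(2)[OF u uv] sqlin(2)[OF u uv] by simp
  qed
  have scale: "\<forall>t\<in>K. \<forall>u\<in>?A. co (t * u) k = t * co u k \<and> sq (t * u) k = t * sq u k"
  proof (intro ballI)
    fix t u assume t: "t \<in> K" and u: "u \<in> ?A"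
    have tu: "t * u \<in> ?A" by (rule alg_mult[OF alg_base[OF t] u])
    show "co (t * u) k = t * co u k \<and> sq (t * u) k = t * sq u k"
      using lin(3)[OF t u tu] sqlin(3)[OF t u tu] by simp
  qed
  have vals: "\<forall>u\<in>?A. co u k \<in> K \<and> sq u k \<in> K \<and> sq (u ^ 2) k = co u k ^ 2"
    using co sq frob by simp
  show ?thesis
    by (rule exI[of _ ?A], rule exI[of _ "\<lambda>u. co u k"], rule exI[of _ "\<lambda>u. sq u k"])
      (intro conjI SA KA add scale vals k(2))
qed

section \<open>Vectors and linear relations over a subfield\<close>

text \<open>Entries from \<open>n\<close> on are zero, unlike in \<open>vec_in\<close>, so that
  equality of functions is equality of vectors.\<close>

definition fvec :: "'a::zero set \<Rightarrow> nat \<Rightarrow> (nat \<Rightarrow> 'a) set" where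
  "fvec K n = {x. (\<forall>i<n. x i \<in> K) \<and> (\<forall>i\<ge>n. x i = 0)}"

definition scal :: "'a::times \<Rightarrow> (nat \<Rightarrow> 'a) \<Rightarrow> nat \<Rightarrow> 'a" where
  "scal t x = (\<lambda>i. t * x i)"

definition unitv :: "nat \<Rightarrow> nat \<Rightarrow> 'a::zero_neq_one" where
  "unitv k = (\<lambda>i. if i = k then 1 else 0)"

lemma scal_apply [simp]: "scal t x i = t * x i"
  by (simp add: scal_def)

lemma fvec_eq_0: "x \<in> fvec K n \<Longrightarrow> (\<And>i. i < n \<Longrightarrow> x i = 0) \<Longrightarrow> x = 0"
  unfolding fvec_def fun_eq_iff zero_fun_apply by (metis (mono_tags, lifting) mem_Collect_eq not_le)

lemma fvec_closed:
  assumes "is_subfield K"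
  shows "0 \<in> fvec K n" "x \<in> fvec K n \<Longrightarrow> y \<in> fvec K n \<Longrightarrow> x + y \<in> fvec K n"
    "x \<in> fvec K n \<Longrightarrow> y \<in> fvec K n \<Longrightarrow> x - y \<in> fvec K n"
    "t \<in> K \<Longrightarrow> x \<in> fvec K n \<Longrightarrow> scal t x \<in> fvec K n"
    "k < n \<Longrightarrow> unitv k \<in> fvec K n"
  using assms by (auto simp: fvec_def subfieldD subfield_diff unitv_def)

lemma matvec_unitv: "k < n \<Longrightarrow> matvec n M (unitv k) = (\<lambda>i. M i k)"
proof
  fix i assume k: "k < n"
  have "matvec n M (unitv k) i = (\<Sum>j<n. if j = k then M i j else 0)"
    unfolding matvec_def unitv_def by (intro sum.cong) auto
  then show "matvec n M (unitv k) i = M i k" using k by simp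
qed

lemma matvec_inverse:
  assumes "\<forall>i<n. \<forall>k<n. (\<Sum>j<n. M i j * N j k) = (if i = k then 1 else 0)" "i < n"
  shows "matvec n M (matvec n N x) i = x i"
proof -
  have "matvec n M (matvec n N x) i = (\<Sum>j<n. \<Sum>k<n. M i j * N j k * x k)"
    by (simp add: matvec_def sum_distrib_left mult.assoc)
  also have "\<dots> = (\<Sum>k<n. (\<Sum>j<n. M i j * N j k) * x k)"
    by (subst sum.swap) (simp add: sum_distrib_right)
  also have "\<dots> = (\<Sum>k<n. if k = i then x k else 0)"
    using assms by (intro sum.cong) auto
  finally show ?thesis using assms(2) by simp
qed

text \<open>\<open>U\<close> is the graph of a functional on a subspace, single-valued by the last
  assumption. By induction on the dimension, the vectors with last coordinate 0 determine all
  coefficients of \<open>v\<close> but one.\<close>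

lemma functional_representable:
  assumes K: "is_subfield K"
    and "\<And>u t. (u, t) \<in> U \<Longrightarrow> vec_in K n u \<and> t \<in> K"
    and "\<And>u t v s. (u, t) \<in> U \<Longrightarrow> (v, s) \<in> U \<Longrightarrow> (u + v, t + s) \<in> U"
    and "\<And>a u t. a \<in> K \<Longrightarrow> (u, t) \<in> U \<Longrightarrow> (scal a u, a * t) \<in> U"
    and "\<And>u t. (u, t) \<in> U \<Longrightarrow> (\<forall>i<n. u i = 0) \<Longrightarrow> t = 0"
  shows "\<exists>v\<in>fvec K n. \<forall>u t. (u, t) \<in> U \<longrightarrow> t = (\<Sum>i<n. u i * v i)"
  using assms(2-)
proof (induction n arbitrary: U)
  case 0
  have "t = 0" if "(u, t) \<in> U" for u t using 0(4)[OF that] by simp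
  then show ?case using fvec_closed(1)[OF K, of 0] by (intro bexI[of _ 0]) auto
next
  case (Suc n)
  let ?U = "{(u, t). (u, t) \<in> U \<and> u n = 0}"
  have "\<exists>v\<in>fvec K n. \<forall>u t. (u, t) \<in> ?U \<longrightarrow> t = (\<Sum>i<n. u i * v i)"
  proof (rule Suc.IH)
    show "vec_in K n u \<and> t \<in> K" if "(u, t) \<in> ?U" for u t
      using that Suc.prems(1)[of u t] by (auto simp: vec_in_def)
    show "(u + v, t + s) \<in> ?U" if "(u, t) \<in> ?U" "(v, s) \<in> ?U" for u t v s
      using that Suc.prems(2)[of u t v s] by (auto simp: plus_fun_def)
    show "(scal a u, a * t) \<in> ?U" if "a \<in> K" "(u, t) \<in> ?U" for a u t
      using that Suc.prems(3)[of a u t] by (auto simp: scal_def)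
    show "t = 0" if "(u, t) \<in> ?U" "\<forall>i<n. u i = 0" for u t
      using that Suc.prems(4)[of u t] by (auto simp: less_Suc_eq)
  qed
  then obtain v where v: "v \<in> fvec K n" "\<And>u t. (u, t) \<in> U \<Longrightarrow> u n = 0 \<Longrightarrow> t = (\<Sum>i<n. u i * v i)"
    by blast
  have v': "v \<in> fvec K (Suc n)" "v n = 0" using v(1) K by (auto simp: fvec_def less_Suc_eq subfieldD)
  show ?case
  proof (cases "\<exists>u t. (u, t) \<in> U \<and> u n \<noteq> 0")
    case False
    then show ?thesis using v v' by (intro bexI[of _ v]) auto
  next
    case True
    then obtain u0 t0 where u0: "(u0, t0) \<in> U" "u0 n \<noteq> 0" by blast
    have u0K: "\<And>i. i \<le> n \<Longrightarrow> u0 i \<in> K" "t0 \<in> K" using Suc.prems(1)[OF u0(1)] by (auto simp: vec_in_def less_Suc_eq_le)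
    \<comment> \<open>Chosen so that the formula holds at \<open>(u0, t0)\<close>; any other vector
      differs from a multiple of \<open>u0\<close> by one with last coordinate 0.\<close>
    let ?c = "(t0 - (\<Sum>i<n. u0 i * v i)) / u0 n"
    let ?v = "v(n := ?c)"
    have "?c \<in> K" using u0K v(1) by (intro subfield_divide[OF K] subfield_diff[OF K] subfield_sum[OF K] subfieldD(4)[OF K])
      (auto simp: fvec_def)
    then have "?v \<in> fvec K (Suc n)" using v'(1) by (auto simp: fvec_def)
    moreover have "t = (\<Sum>i<Suc n. u i * ?v i)" if ut: "(u, t) \<in> U" for u t
    proof -
      let ?a = "u n / u0 n"
      have "u n \<in> K" using Suc.prems(1)[OF ut] by (auto simp: vec_in_def)
      then have aK: "- ?a \<in> K" using u0K by (intro subfieldD(5)[OF K] subfield_divide[OF K]) auto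
      have "(u + scal (- ?a) u0, t + (- ?a) * t0) \<in> U"
        by (rule Suc.prems(2)[OF ut Suc.prems(3)[OF aK u0(1)]])
      moreover have "(u + scal (- ?a) u0) n = 0" using u0(2) by simp
      ultimately have "t + (- ?a) * t0 = (\<Sum>i<n. (u + scal (- ?a) u0) i * v i)" by (rule v(2))
      also have "\<dots> = (\<Sum>i<n. u i * v i) - ?a * (\<Sum>i<n. u0 i * v i)"
        by (simp add: algebra_simps sum_subtractf sum_distrib_left)
      finally have "t = (\<Sum>i<n. u i * v i) + ?a * (t0 - (\<Sum>i<n. u0 i * v i))"
        by (simp add: algebra_simps)
      also have "?a * (t0 - (\<Sum>i<n. u0 i * v i)) = u n * ?c" by simp
      finally show ?thesis by simp
    qed
    ultimately show ?thesis by (intro bexI[of _ ?v]) auto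
  qed
qed

text \<open>Injectivity makes the functional sending \<open>matvec n M x\<close> to
  \<open>x k\<close> well defined on the image; a vector over \<open>K\<close> representing it is
  row \<open>k\<close> of a left inverse.\<close>

lemma trivial_kernel_imp_invertible:
  assumes K: "is_subfield K" and M: "mat_in K n M"
    and ker: "\<And>x. x \<in> fvec K n \<Longrightarrow> (\<forall>i<n. matvec n M x i = 0) \<Longrightarrow> x = 0"
  shows "invertible_over K n M"
proof -
  have row: "\<exists>v\<in>fvec K n. \<forall>x\<in>fvec K n. x k = (\<Sum>i<n. matvec n M x i * v i)" if k: "k < n" for k
  proof -
    let ?U = "{(matvec n M x, x k) | x. x \<in> fvec K n}"
    have "\<exists>v\<in>fvec K n. \<forall>u t. (u, t) \<in> ?U \<longrightarrow> t = (\<Sum>i<n. u i * v i)"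
    proof (rule functional_representable[OF K])
      show "vec_in K n u \<and> t \<in> K" if "(u, t) \<in> ?U" for u t
        using that k M by (auto simp: vec_in_def mat_in_def matvec_def fvec_def
            intro!: subfield_sum[OF K] subfieldD(4)[OF K])
      show "(u + v, t + s) \<in> ?U" if ut: "(u, t) \<in> ?U" "(v, s) \<in> ?U" for u t v s
      proof -
        obtain x y where "u = matvec n M x" "t = x k" "v = matvec n M y" "s = y k" "x \<in> fvec K n" "y \<in> fvec K n"
          using ut by blast
        moreover have "matvec n M x + matvec n M y = matvec n M (x + y)"
          by (simp add: matvec_def fun_eq_iff distrib_left sum.distrib)
        ultimately show ?thesis using fvec_closed(2)[OF K] by (auto intro!: exI[of _ "x + y"])
      qed
      show "(scal a u, a * t) \<in> ?U" if a: "a \<in> K" and ut: "(u, t) \<in> ?U" for a u t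
      proof -
        obtain x where "u = matvec n M x" "t = x k" "x \<in> fvec K n" using ut by blast
        moreover have "scal a (matvec n M x) = matvec n M (scal a x)"
          by (simp add: matvec_def fun_eq_iff sum_distrib_left ac_simps)
        ultimately show ?thesis using fvec_closed(4)[OF K a] by (auto intro!: exI[of _ "scal a x"])
      qed
      show "t = 0" if "(u, t) \<in> ?U" "\<forall>i<n. u i = 0" for u t
        using that ker by fastforce
    qed
    then show ?thesis by blast
  qed
  then have "\<forall>k\<in>{..<n}. \<exists>v\<in>fvec K n. \<forall>x\<in>fvec K n. x k = (\<Sum>i<n. matvec n M x i * v i)" by blast
  from bchoice[OF this[unfolded Bex_def]]
  obtain Z where Z: "\<forall>k\<in>{..<n}. Z k \<in> fvec K n \<and> (\<forall>x\<in>fvec K n. x k = (\<Sum>i<n. matvec n M x i * Z k i))" ..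
  have left: "\<forall>i<n. \<forall>k<n. (\<Sum>j<n. Z i j * M j k) = (if i = k then 1 else 0)"
  proof (intro allI impI)
    fix i k assume i: "i < n" and k: "k < n"
    have "unitv k \<in> fvec K n" using fvec_closed(5)[OF K k] .
    then have "unitv k i = (\<Sum>j<n. matvec n M (unitv k) j * Z i j)" using Z i by blast
    then show "(\<Sum>j<n. Z i j * M j k) = (if i = k then 1 else 0)"
      unfolding matvec_unitv[OF k] by (simp add: unitv_def mult.commute)
  qed
  moreover have "mat_in K n Z" using Z by (auto simp: mat_in_def fvec_def)
  ultimately show ?thesis
    unfolding invertible_over_def using M left_inverse_imp_right_inverse[OF left] by blast
qed

section \<open>Partial linear isomorphisms as relations\<close>

definition lin_rel :: "'a::field set \<Rightarrow> nat \<Rightarrow> ((nat \<Rightarrow> 'a) \<times> (nat \<Rightarrow> 'a)) set \<Rightarrow> bool" where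
  "lin_rel K n G \<longleftrightarrow> G \<subseteq> fvec K n \<times> fvec K n \<and> (0, 0) \<in> G
    \<and> (\<forall>x y x' y'. (x, y) \<in> G \<longrightarrow> (x', y') \<in> G \<longrightarrow> (x + x', y + y') \<in> G)
    \<and> (\<forall>t\<in>K. \<forall>x y. (x, y) \<in> G \<longrightarrow> (scal t x, scal t y) \<in> G)"

text \<open>For a linear relation this says both single-valued and injective. The encoding treats
  domain and range alike, so converses and unions of chains stay within it.\<close>

definition bi_injective :: "('v::zero \<times> 'w::zero) set \<Rightarrow> bool" where
  "bi_injective G \<longleftrightarrow> (\<forall>x y. (x, y) \<in> G \<longrightarrow> (x = 0 \<longleftrightarrow> y = 0))"

definition adjoin :: "'a::field set \<Rightarrow> ((nat \<Rightarrow> 'a) \<times> (nat \<Rightarrow> 'a)) set \<Rightarrow> (nat \<Rightarrow> 'a) \<Rightarrow> (nat \<Rightarrow> 'a) \<Rightarrow>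
    ((nat \<Rightarrow> 'a) \<times> (nat \<Rightarrow> 'a)) set" where
  "adjoin K G x y = {(z + scal t x, w + scal t y) | z w t. (z, w) \<in> G \<and> t \<in> K}"

lemma lin_relD:
  assumes "lin_rel K n G"
  shows "(x, y) \<in> G \<Longrightarrow> x \<in> fvec K n" "(x, y) \<in> G \<Longrightarrow> y \<in> fvec K n" "(0, 0) \<in> G"
    "(x, y) \<in> G \<Longrightarrow> (x', y') \<in> G \<Longrightarrow> (x + x', y + y') \<in> G"
    "t \<in> K \<Longrightarrow> (x, y) \<in> G \<Longrightarrow> (scal t x, scal t y) \<in> G"
  using assms unfolding lin_rel_def by blast+

lemma lin_rel_diff:
  assumes K: "is_subfield K" and "lin_rel K n G" "(x, y) \<in> G" "(x', y') \<in> G"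
  shows "(x - x', y - y') \<in> G"
proof -
  have "-1 \<in> K" using K by (simp add: subfieldD)
  then have "(x + scal (-1) x', y + scal (-1) y') \<in> G"
    using assms lin_relD(4,5) by metis
  moreover have "x + scal (-1) x' = x - x'" "y + scal (-1) y' = y - y'" by (auto simp: fun_eq_iff)
  ultimately show ?thesis by simp
qed

lemma lin_rel_sum:
  fixes m :: nat
  assumes K: "is_subfield K" and G: "lin_rel K n G" and "\<And>j. j < m \<Longrightarrow> a j \<in> K"
    "\<And>j. j < m \<Longrightarrow> (x j, y j) \<in> G"
  shows "((\<lambda>i. \<Sum>j<m. a j * x j i), (\<lambda>i. \<Sum>j<m. a j * y j i)) \<in> G"
  using assms(3,4)
proof (induction m)
  case 0
  have "(\<lambda>i. 0) = (0 :: nat \<Rightarrow> 'a)" by (simp add: fun_eq_iff)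
  then show ?case using lin_relD(3)[OF G] by simp
next
  case (Suc m)
  have "((\<lambda>i. \<Sum>j<m. a j * x j i) + scal (a m) (x m), (\<lambda>i. \<Sum>j<m. a j * y j i) + scal (a m) (y m)) \<in> G"
    using Suc by (intro lin_relD(4,5)[OF G]) auto
  moreover have "(\<lambda>i. \<Sum>j<m. a j * z j i) + scal (a m) (z m) = (\<lambda>i. \<Sum>j<Suc m. a j * z j i)" for z
    by (simp add: fun_eq_iff)
  ultimately show ?case by simp
qed

lemma bi_injectiveD: "bi_injective G \<Longrightarrow> (x, y) \<in> G \<Longrightarrow> x = 0 \<longleftrightarrow> y = 0"
  unfolding bi_injective_def by blast

lemma lin_rel_adjoin:
  assumes K: "is_subfield K" and G: "lin_rel K n G" and xy: "x \<in> fvec K n" "y \<in> fvec K n"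
  shows "lin_rel K n (adjoin K G x y)" "G \<subseteq> adjoin K G x y" "(x, y) \<in> adjoin K G x y"
proof -
  have I: "(z + scal t x, w + scal t y) \<in> adjoin K G x y" if "(z, w) \<in> G" "t \<in> K" for z w t
    using that unfolding adjoin_def by blast
  have s0: "z + scal 0 u = z" for z u :: "nat \<Rightarrow> 'a" by (simp add: fun_eq_iff)
  show sub: "G \<subseteq> adjoin K G x y"
  proof clarify
    fix z w assume "(z, w) \<in> G"
    from I[OF this subfieldD(1)[OF K]] show "(z, w) \<in> adjoin K G x y" unfolding s0 .
  qed
  have "0 + scal 1 u = u" for u :: "nat \<Rightarrow> 'a" by (simp add: fun_eq_iff)
  then show "(x, y) \<in> adjoin K G x y" using I[OF lin_relD(3)[OF G] subfieldD(2)[OF K]] by simp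
  show "lin_rel K n (adjoin K G x y)"
    unfolding lin_rel_def
  proof (intro conjI allI impI ballI)
    show "adjoin K G x y \<subseteq> fvec K n \<times> fvec K n"
      using lin_relD(1,2)[OF G] xy unfolding adjoin_def by (auto intro!: fvec_closed(2,4)[OF K])
    show "(0, 0) \<in> adjoin K G x y" using sub lin_relD(3)[OF G] by blast
  next
    fix a b a' b' assume "(a, b) \<in> adjoin K G x y" "(a', b') \<in> adjoin K G x y"
    then obtain z w t z' w' t' where *: "a = z + scal t x" "b = w + scal t y" "(z, w) \<in> G" "t \<in> K"
      "a' = z' + scal t' x" "b' = w' + scal t' y" "(z', w') \<in> G" "t' \<in> K"
      unfolding adjoin_def by blast
    have "(z + z' + scal (t + t') x, w + w' + scal (t + t') y) \<in> adjoin K G x y"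
      by (rule I[OF lin_relD(4)[OF G *(3,7)] subfieldD(3)[OF K *(4,8)]])
    moreover have "a + a' = z + z' + scal (t + t') x" "b + b' = w + w' + scal (t + t') y"
      unfolding * by (auto simp: fun_eq_iff algebra_simps)
    ultimately show "(a + a', b + b') \<in> adjoin K G x y" by simp
  next
    fix s a b assume s: "s \<in> K" and "(a, b) \<in> adjoin K G x y"
    then obtain z w t where *: "a = z + scal t x" "b = w + scal t y" "(z, w) \<in> G" "t \<in> K"
      unfolding adjoin_def by blast
    have "(scal s z + scal (s * t) x, scal s w + scal (s * t) y) \<in> adjoin K G x y"
      by (rule I[OF lin_relD(5)[OF G s *(3)] subfieldD(4)[OF K s *(4)]])
    moreover have "scal s a = scal s z + scal (s * t) x" "scal s b = scal s w + scal (s * t) y"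
      unfolding * by (auto simp: fun_eq_iff algebra_simps)
    ultimately show "(scal s a, scal s b) \<in> adjoin K G x y" by simp
  qed
qed

text \<open>If the new pair enters with coefficient \<open>t \<noteq> 0\<close>, a vanishing
  component would make \<open>x\<close> a multiple of an element of the domain, or \<open>y\<close>
  one of an element of the range.\<close>

lemma bi_injective_adjoin:
  assumes K: "is_subfield K" and G: "lin_rel K n G" "bi_injective G"
    and x: "x \<notin> Domain G" and y: "y \<notin> Range G"
  shows "bi_injective (adjoin K G x y)"
proof -
  have solve: "u = scal (- inverse t) z" if "z + scal t u = 0" "t \<noteq> 0" for z u :: "nat \<Rightarrow> 'a" and t
  proof
    fix i
    have "z i + t * u i = 0" using that(1) by (simp add: fun_eq_iff)
    then have "t * u i = - z i" by (metis add_eq_0_iff)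
    then show "u i = scal (- inverse t) z i" using that(2) by (simp add: field_simps)
  qed
  have "z + scal t x = 0 \<longleftrightarrow> w + scal t y = 0" if zw: "(z, w) \<in> G" and t: "t \<in> K" for z w t
  proof (cases "t = 0")
    case True
    have "scal 0 u = 0" for u :: "nat \<Rightarrow> 'a" by (simp add: fun_eq_iff)
    then show ?thesis using bi_injectiveD[OF G(2) zw] True by simp
  next
    case False
    have "- inverse t \<in> K" using t by (simp add: subfieldD[OF K])
    from lin_relD(5)[OF G(1) this zw] show ?thesis
      using solve[OF _ False] x y by (metis Domain.DomainI Range.RangeI)
  qed
  then show ?thesis unfolding bi_injective_def adjoin_def by (auto simp del: plus_fun_apply)
qed

text \<open>Zorn's lemma. \<open>Q\<close> compares two pairs, as preservation of a bilinear form
  does, and any two pairs from the union of a chain already lie in one member.\<close>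

lemma maximal_lin_rel:
  assumes G0: "lin_rel K n G0" "bi_injective G0" "\<forall>g\<in>G0. \<forall>h\<in>G0. Q g h"
  shows "\<exists>G. lin_rel K n G \<and> bi_injective G \<and> (\<forall>g\<in>G. \<forall>h\<in>G. Q g h) \<and> G0 \<subseteq> G
    \<and> (\<forall>G'. lin_rel K n G' \<longrightarrow> bi_injective G' \<longrightarrow> (\<forall>g\<in>G'. \<forall>h\<in>G'. Q g h) \<longrightarrow> G \<subseteq> G' \<longrightarrow> G' = G)"
proof -
  let ?S = "{G. lin_rel K n G \<and> bi_injective G \<and> (\<forall>g\<in>G. \<forall>h\<in>G. Q g h) \<and> G0 \<subseteq> G}"
  have "\<exists>M\<in>?S. \<forall>X\<in>?S. M \<subseteq> X \<longrightarrow> X = M"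
  proof (rule subset_Zorn_nonempty)
    show "?S \<noteq> {}" using G0 by blast
    fix C assume C: "C \<noteq> {}" "subset.chain ?S C"
    have CS: "X \<in> ?S" if "X \<in> C" for X using C(2) that by (auto simp: subset.chain_def)
    have two: "\<exists>X\<in>C. g \<in> X \<and> h \<in> X" if gh: "g \<in> \<Union>C" "h \<in> \<Union>C" for g h
    proof -
      obtain X Y where XY: "X \<in> C" "g \<in> X" "Y \<in> C" "h \<in> Y" using gh by blast
      then have "X \<subseteq> Y \<or> Y \<subseteq> X" using C(2) by (auto simp: subset_chain_def)
      then show ?thesis using XY by blast
    qed
    have "lin_rel K n (\<Union>C)"
      unfolding lin_rel_def
    proof (intro conjI allI impI ballI)
      show "\<Union>C \<subseteq> fvec K n \<times> fvec K n" using CS by (fastforce simp: lin_rel_def)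
      show "(0, 0) \<in> \<Union>C" using C(1) CS lin_relD(3) by blast
    next
      fix x y x' y' assume "(x, y) \<in> \<Union>C" "(x', y') \<in> \<Union>C"
      from two[OF this] obtain X where X: "X \<in> C" "(x, y) \<in> X" "(x', y') \<in> X" by blast
      then have "lin_rel K n X" using CS by blast
      from lin_relD(4)[OF this X(2,3)] show "(x + x', y + y') \<in> \<Union>C" using X(1) by blast
    next
      fix t x y assume "t \<in> K" "(x, y) \<in> \<Union>C"
      then obtain X where X: "X \<in> C" "(x, y) \<in> X" by blast
      then have "lin_rel K n X" using CS by blast
      from lin_relD(5)[OF this \<open>t \<in> K\<close> X(2)] show "(scal t x, scal t y) \<in> \<Union>C" using X(1) by blast
    qed
    moreover have "bi_injective (\<Union>C)" using CS unfolding bi_injective_def by blast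
    moreover have "\<forall>g\<in>\<Union>C. \<forall>h\<in>\<Union>C. Q g h"
    proof (intro ballI)
      fix g h assume "g \<in> \<Union>C" "h \<in> \<Union>C"
      from two[OF this] obtain X where X: "X \<in> C" "g \<in> X" "h \<in> X" by blast
      then show "Q g h" using CS[OF X(1)] by blast
    qed
    moreover have "G0 \<subseteq> \<Union>C" using C(1) CS by blast
    ultimately show "\<Union>C \<in> ?S" by simp
  qed
  then obtain G where G: "G \<in> ?S" "\<forall>X\<in>?S. G \<subseteq> X \<longrightarrow> X = G" by (elim bexE)
  have "G' = G" if "lin_rel K n G'" "bi_injective G'" "\<forall>g\<in>G'. \<forall>h\<in>G'. Q g h" "G \<subseteq> G'" for G'
  proof -
    have "G' \<in> ?S" using that G(1) by auto
    then show ?thesis using G(2) that(4) by blast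
  qed
  then show ?thesis using G(1) by (intro exI[of _ G]) simp
qed

text \<open>The images of the unit vectors are the columns of \<open>M\<close>, and injectivity of
  \<open>G\<close> gives it a trivial kernel.\<close>

lemma total_lin_rel_matrix:
  assumes K: "is_subfield K" and G: "lin_rel K n G" "bi_injective G" and tot: "fvec K n \<subseteq> Domain G"
  shows "\<exists>M. invertible_over K n M \<and> (\<forall>x\<in>fvec K n. (x, matvec n M x) \<in> G)"
proof -
  have "\<forall>j\<in>{..<n}. \<exists>y. (unitv j, y) \<in> G"
  proof
    fix j assume "j \<in> {..<n}"
    then have "unitv j \<in> fvec K n" using fvec_closed(5)[OF K] by simp
    then show "\<exists>y. (unitv j, y) \<in> G" using tot by blast
  qed
  from bchoice[OF this] obtain Y where Y: "\<forall>j\<in>{..<n}. (unitv j, Y j) \<in> G" ..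
  define M where "M = (\<lambda>i j. Y j i)"
  have YV: "Y j \<in> fvec K n" if "j < n" for j using Y that lin_relD(2)[OF G(1)] by auto
  have graph: "(x, matvec n M x) \<in> G" if x: "x \<in> fvec K n" for x
  proof -
    have "((\<lambda>i. \<Sum>j<n. x j * unitv j i), (\<lambda>i. \<Sum>j<n. x j * Y j i)) \<in> G"
      using Y x by (intro lin_rel_sum[OF K G(1)]) (auto simp: fvec_def)
    moreover have "(\<lambda>i. \<Sum>j<n. x j * unitv j i) = x"
    proof
      fix i
      have "(\<Sum>j<n. x j * unitv j i) = (\<Sum>j<n. if j = i then x j else 0)"
        unfolding unitv_def by (intro sum.cong) auto
      then show "(\<Sum>j<n. x j * unitv j i) = x i" using x by (simp add: fvec_def)
    qed
    moreover have "(\<lambda>i. \<Sum>j<n. x j * Y j i) = matvec n M x"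
      by (simp add: matvec_def M_def mult.commute)
    ultimately show ?thesis by simp
  qed
  have "invertible_over K n M"
  proof (rule trivial_kernel_imp_invertible[OF K])
    show "mat_in K n M" using YV by (auto simp: mat_in_def M_def fvec_def)
    fix x assume x: "x \<in> fvec K n" "\<forall>i<n. matvec n M x i = 0"
    have "matvec n M x = 0" using lin_relD(2)[OF G(1) graph[OF x(1)]] x(2) by (intro fvec_eq_0) auto
    then show "x = 0" using bi_injectiveD[OF G(2) graph[OF x(1)]] by simp
  qed
  then show ?thesis using graph by blast
qed

lemma lin_rel_converse: "lin_rel K n G \<Longrightarrow> lin_rel K n (G\<inverse>)"
  unfolding lin_rel_def by blast

text \<open>This replaces a dimension count: the converse is total, hence given by an invertible
  matrix, whose values exhaust \<open>fvec K n\<close>.\<close>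

lemma onto_lin_rel_total:
  assumes K: "is_subfield K" and G: "lin_rel K n G" "bi_injective G" and onto: "fvec K n \<subseteq> Range G"
  shows "fvec K n \<subseteq> Domain G"
proof
  fix x assume x: "x \<in> fvec K n"
  have "bi_injective (G\<inverse>)" using G(2) unfolding bi_injective_def by blast
  then obtain M where M: "invertible_over K n M" "\<forall>y\<in>fvec K n. (y, matvec n M y) \<in> G\<inverse>"
    using total_lin_rel_matrix[OF K lin_rel_converse[OF G(1)]] onto by auto
  then obtain N where N: "mat_in K n N" "\<forall>i<n. \<forall>k<n. (\<Sum>j<n. M i j * N j k) = (if i = k then 1 else 0)"
    unfolding invertible_over_def by blast
  define y where "y = (\<lambda>j. if j < n then matvec n N x j else 0)"
  have y: "y \<in> fvec K n" using N(1) x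
    by (auto simp: y_def fvec_def matvec_def mat_in_def intro!: subfield_sum[OF K] subfieldD(4)[OF K])
  have "matvec n M y = x"
  proof
    fix i show "matvec n M y i = x i"
    proof (cases "i < n")
      case True
      have "matvec n M y = matvec n M (matvec n N x)" by (simp add: matvec_def y_def fun_eq_iff)
      then show ?thesis using matvec_inverse[OF N(2) True] by simp
    next
      case False
      have "matvec n M y \<in> fvec K n" using M(2) y lin_relD(1)[OF G(1)] by blast
      then show ?thesis using x False by (simp add: fvec_def)
    qed
  qed
  then show "x \<in> Domain G" using M(2) y by (metis Domain.DomainI converse_iff)
qed

section \<open>Extending partial isometries\<close>

lemma bf_eval_add_left: "bf_eval n B (x + y) z = bf_eval n B x z + bf_eval n B y z"
  by (simp add: bf_eval_def algebra_simps sum.distrib)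

lemma bf_eval_add_right: "bf_eval n B z (x + y) = bf_eval n B z x + bf_eval n B z y"
  by (simp add: bf_eval_def algebra_simps sum.distrib)

lemma bf_eval_scal_left: "bf_eval n B (scal t x) z = t * bf_eval n B x z"
  by (simp add: bf_eval_def sum_distrib_left ac_simps)

lemma bf_eval_scal_right: "bf_eval n B z (scal t x) = t * bf_eval n B z x"
  by (simp add: bf_eval_def sum_distrib_left ac_simps)

lemma bf_eval_zero: "bf_eval n B 0 z = 0" "bf_eval n B z 0 = 0"
  by (simp_all add: bf_eval_def)

lemmas bf_eval_linear = bf_eval_add_left bf_eval_add_right bf_eval_scal_left bf_eval_scal_right bf_eval_zero

definition lin_subspace :: "'a::field set \<Rightarrow> nat \<Rightarrow> (nat \<Rightarrow> 'a) set \<Rightarrow> bool" where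
  "lin_subspace K n Y \<longleftrightarrow> Y \<subseteq> fvec K n \<and> 0 \<in> Y \<and> (\<forall>x\<in>Y. \<forall>y\<in>Y. x + y \<in> Y) \<and> (\<forall>t\<in>K. \<forall>x\<in>Y. scal t x \<in> Y)"

section \<open>Norms and orthogonality in characteristic 2\<close>

locale symmetric_form =
  fixes K :: "'a::field set" and n :: nat and B :: "nat \<Rightarrow> nat \<Rightarrow> 'a"
  assumes K: "is_subfield K" and char: "CHAR('a) = 2" and nonsing: "nonsingular_symmetric_bf K n B"
begin

abbreviation V where "V \<equiv> fvec K n"
abbreviation b where "b \<equiv> bf_eval n B"

text \<open>Zero is included; in characteristic 2 the norm \<open>b x x\<close> is additive, so this
  set is a subspace.\<close>

definition isotropic :: "(nat \<Rightarrow> 'a) set" where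
  "isotropic = {x\<in>V. b x x = 0}"

definition perp :: "(nat \<Rightarrow> 'a) set \<Rightarrow> (nat \<Rightarrow> 'a) set" where
  "perp Y = {x\<in>V. \<forall>y\<in>Y. b x y = 0}"

lemma b_sym: "b x y = b y x"
proof -
  have "b x y = (\<Sum>j<n. \<Sum>i<n. B i j * x i * y j)"
    unfolding bf_eval_def by (rule sum.swap)
  also have "\<dots> = b y x"
    unfolding bf_eval_def using nonsing
    by (intro sum.cong refl) (auto simp: nonsingular_symmetric_bf_def ac_simps)
  finally show ?thesis .
qed

lemma b_closed: "x \<in> V \<Longrightarrow> y \<in> V \<Longrightarrow> b x y \<in> K"
  using nonsing unfolding bf_eval_def nonsingular_symmetric_bf_def mat_in_def
  by (intro subfield_sum[OF K] subfieldD(4)[OF K]) (auto simp: fvec_def)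

lemma b_self_add: "b (x + y) (x + y) = b x x + b y y"
proof -
  have "b (x + y) (x + y) = b x x + b y y + (b x y + b x y)"
    using b_sym[of y x] by (simp add: bf_eval_linear)
  then show ?thesis using char2_add_self[OF char, of "b x y"] by simp
qed

lemma b_nondegenerate:
  assumes "x \<in> V" "\<And>y. y \<in> V \<Longrightarrow> b x y = 0"
  shows "x = 0"
proof (rule fvec_eq_0[OF assms(1)])
  have "b x y = 0" if y: "vec_in K n y" for y
  proof -
    let ?y = "\<lambda>i. if i < n then y i else 0"
    have "?y \<in> V" using y by (auto simp: fvec_def vec_in_def)
    moreover have "b x y = b x ?y" by (simp add: bf_eval_def)
    ultimately show ?thesis using assms(2) by simp
  qed
  moreover have "vec_in K n x" using assms(1) by (auto simp: vec_in_def fvec_def)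
  ultimately show "x i = 0" if "i < n" for i
    using nonsing that unfolding nonsingular_symmetric_bf_def by blast
qed

text \<open>By nondegeneracy, \<open>x\<close> is determined by the coefficient vector
  \<open>D x\<close> of the functional \<open>b x\<close>, so a functional of \<open>x\<close> on a
  subspace becomes one of \<open>D x\<close>, to which coordinatewise representation
  applies.\<close>

lemma b_representable:
  assumes U: "\<And>x t. (x, t) \<in> U \<Longrightarrow> x \<in> V \<and> t \<in> K"
    and add: "\<And>x t y s. (x, t) \<in> U \<Longrightarrow> (y, s) \<in> U \<Longrightarrow> (x + y, t + s) \<in> U"
    and scl: "\<And>a x t. a \<in> K \<Longrightarrow> (x, t) \<in> U \<Longrightarrow> (scal a x, a * t) \<in> U"
    and zero: "\<And>t. (0, t) \<in> U \<Longrightarrow> t = 0"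
  shows "\<exists>v\<in>V. \<forall>x t. (x, t) \<in> U \<longrightarrow> t = b x v"
proof -
  define D where "D = (\<lambda>x i. \<Sum>j<n. B j i * x j)"
  let ?U = "{(D x, t) | x t. (x, t) \<in> U}"
  have bD: "b x v = (\<Sum>i<n. D x i * v i)" for x v
    unfolding bf_eval_def D_def by (subst sum.swap) (simp add: sum_distrib_right)
  have "\<exists>v\<in>V. \<forall>u t. (u, t) \<in> ?U \<longrightarrow> t = (\<Sum>i<n. u i * v i)"
  proof (rule functional_representable[OF K])
    show "vec_in K n u \<and> t \<in> K" if "(u, t) \<in> ?U" for u t
    proof -
      obtain x where x: "u = D x" "x \<in> V" "t \<in> K" using \<open>(u, t) \<in> ?U\<close> U by blast
      then have "D x i \<in> K" if "i < n" for i
        using nonsing that unfolding D_def nonsingular_symmetric_bf_def mat_in_def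
        by (intro subfield_sum[OF K] subfieldD(4)[OF K]) (auto simp: fvec_def)
      then show ?thesis using x by (simp add: vec_in_def)
    qed
    show "(u + v, t + s) \<in> ?U" if ut: "(u, t) \<in> ?U" "(v, s) \<in> ?U" for u t v s
    proof -
      obtain x y where xy: "u = D x" "v = D y" "(x, t) \<in> U" "(y, s) \<in> U" using ut by blast
      have "D x + D y = D (x + y)" by (simp add: D_def fun_eq_iff distrib_left sum.distrib)
      then show ?thesis using add[OF xy(3,4)] xy(1,2) by auto
    qed
    show "(scal a u, a * t) \<in> ?U" if a: "a \<in> K" and ut: "(u, t) \<in> ?U" for a u t
    proof -
      obtain x where x: "u = D x" "(x, t) \<in> U" using ut by blast
      have "scal a (D x) = D (scal a x)" by (simp add: D_def fun_eq_iff sum_distrib_left ac_simps)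
      then show ?thesis using scl[OF a x(2)] x(1) by auto
    qed
    show "t = 0" if ut: "(u, t) \<in> ?U" "\<forall>i<n. u i = 0" for u t
    proof -
      obtain x where x: "u = D x" "(x, t) \<in> U" using ut(1) by blast
      have "b x y = 0" for y unfolding bD using ut(2) x(1) by simp
      then have "x = 0" using U[OF x(2)] by (intro b_nondegenerate) auto
      then show ?thesis using zero x(2) by simp
    qed
  qed
  then obtain v where v: "v \<in> V" "\<And>u t. (u, t) \<in> ?U \<Longrightarrow> t = (\<Sum>i<n. u i * v i)" by blast
  have "t = b x v" if "(x, t) \<in> U" for x t
    unfolding bD using that by (intro v(2)) blast
  then show ?thesis using v(1) by blast
qed

text \<open>\<open>w\<close> represents the functional with value \<open>t\<close> at
  \<open>y + scal t v\<close>, which is well defined because \<open>v\<close> lies outside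
  \<open>Y\<close>.\<close>

lemma separating_vector:
  assumes Y: "lin_subspace K n Y" and v: "v \<in> V" "v \<notin> Y"
  shows "\<exists>w\<in>V. (\<forall>y\<in>Y. b y w = 0) \<and> b v w = 1"
proof -
  have YD: "y \<in> V" "y + y' \<in> Y" "scal t y \<in> Y" if "y \<in> Y" "y' \<in> Y" "t \<in> K" for y y' t
    using Y that unfolding lin_subspace_def by blast+
  let ?U = "{(y + scal t v, t) | y t. y \<in> Y \<and> t \<in> K}"
  have "\<exists>w\<in>V. \<forall>x t. (x, t) \<in> ?U \<longrightarrow> t = b x w"
  proof (rule b_representable)
    show "x \<in> V \<and> t \<in> K" if "(x, t) \<in> ?U" for x t
      using that YD(1) v(1) by (auto intro!: fvec_closed(2,4)[OF K])
    show "(x + y, t + s) \<in> ?U" if xy: "(x, t) \<in> ?U" "(y, s) \<in> ?U" for x t y s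
    proof -
      obtain p q where pq: "x = p + scal t v" "y = q + scal s v" "p \<in> Y" "q \<in> Y" "t \<in> K" "s \<in> K"
        using xy by blast
      have "x + y = (p + q) + scal (t + s) v" unfolding pq by (simp add: fun_eq_iff algebra_simps)
      moreover have "p + q \<in> Y" "t + s \<in> K" using pq YD(2) subfieldD(3)[OF K] by auto
      ultimately show ?thesis by blast
    qed
    show "(scal a x, a * t) \<in> ?U" if a: "a \<in> K" and x: "(x, t) \<in> ?U" for a x t
    proof -
      obtain p where p: "x = p + scal t v" "p \<in> Y" "t \<in> K" using x by blast
      have "scal a x = scal a p + scal (a * t) v" unfolding p by (simp add: fun_eq_iff algebra_simps)
      moreover have "scal a p \<in> Y" "a * t \<in> K" using a p YD(3) subfieldD(4)[OF K] by auto
      ultimately show ?thesis by blast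
    qed
    show "t = 0" if "(0, t) \<in> ?U" for t
    proof (rule ccontr)
      assume t: "t \<noteq> 0"
      obtain p where p: "0 = p + scal t v" "p \<in> Y" "t \<in> K" using \<open>(0, t) \<in> ?U\<close> by blast
      have "v = scal (- inverse t) p"
      proof
        fix i
        have "p i + t * v i = 0" using fun_cong[OF p(1), of i] by simp
        then have "t * v i = - p i" by (metis add_eq_0_iff)
        then show "v i = scal (- inverse t) p i" using t by (simp add: field_simps)
      qed
      moreover have "- inverse t \<in> K" using p(3) by (simp add: subfieldD[OF K])
      ultimately have "v \<in> Y" using YD(3) p(2) by simp
      then show False using v(2) by simp
    qed
  qed
  then obtain w where w: "w \<in> V" "\<And>y t. y \<in> Y \<Longrightarrow> t \<in> K \<Longrightarrow> t = b (y + scal t v) w" by blast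
  have y0: "b y w = 0" if "y \<in> Y" for y
    using w(2)[OF that subfieldD(1)[OF K]] by (simp add: bf_eval_linear)
  moreover have "0 \<in> Y" using Y by (simp add: lin_subspace_def)
  then have "b v w = 1" using w(2)[OF _ subfieldD(2)[OF K], of 0] by (simp add: bf_eval_linear)
  ultimately show ?thesis using w(1) by auto
qed

lemma lin_subspace_isotropic: "lin_subspace K n isotropic"
  unfolding lin_subspace_def isotropic_def
  by (auto simp: b_self_add bf_eval_zero bf_eval_scal_left bf_eval_scal_right intro: fvec_closed[OF K])

lemma lin_subspace_perp: "lin_subspace K n (perp Y)"
  unfolding lin_subspace_def perp_def
  by (auto simp: bf_eval_linear intro: fvec_closed[OF K])

text \<open>A vector of nonzero norm is separated from the isotropic subspace by some
  \<open>w\<close> orthogonal to that subspace. The use: the quadratic condition of being isotropic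
  can be enforced by linear ones.\<close>

lemma perp_perp_isotropic:
  assumes "r \<in> V" "\<And>s. s \<in> perp isotropic \<Longrightarrow> b s r = 0"
  shows "b r r = 0"
proof (rule ccontr)
  assume "b r r \<noteq> 0"
  then have "r \<notin> isotropic" by (simp add: isotropic_def)
  then obtain w where w: "w \<in> V" "\<forall>y\<in>isotropic. b y w = 0" "b r w = 1"
    using separating_vector[OF lin_subspace_isotropic assms(1)] by blast
  have "w \<in> perp isotropic" using w(1,2) b_sym by (auto simp: perp_def)
  then show False using assms(2) w(3) b_sym[of w r] by simp
qed

end

section \<open>Witt extension for adjoint pairs\<close>

lemma lin_subspace_Domain: "lin_rel K n G \<Longrightarrow> lin_subspace K n (Domain G)"
  unfolding lin_rel_def lin_subspace_def by blast

lemma lin_subspace_Range: "lin_rel K n G \<Longrightarrow> lin_subspace K n (Range G)"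
  unfolding lin_rel_def lin_subspace_def by blast

text \<open>What the descent supplies after rescaling: norm-preserving maps in both directions,
  adjoint to each other but possibly singular. Were \<open>P\<close> a bijective isometry,
  \<open>N\<close> would be its inverse on \<open>fvec K n\<close>.\<close>

locale adjoint_pair = B: symmetric_form K n B + C: symmetric_form K n C
  for K :: "'a::field set" and n :: nat and B C :: "nat \<Rightarrow> nat \<Rightarrow> 'a" +
  fixes P N :: "(nat \<Rightarrow> 'a) \<Rightarrow> nat \<Rightarrow> 'a"
  assumes P_closed: "x \<in> fvec K n \<Longrightarrow> P x \<in> fvec K n" and N_closed: "x \<in> fvec K n \<Longrightarrow> N x \<in> fvec K n"
    and P_add: "P (x + y) = P x + P y" and P_scal: "P (scal t x) = scal t (P x)"
    and P_norm: "x \<in> fvec K n \<Longrightarrow> bf_eval n B (P x) (P x) = bf_eval n C x x"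
    and N_norm: "x \<in> fvec K n \<Longrightarrow> bf_eval n C (N x) (N x) = bf_eval n B x x"
    and adjoint: "x \<in> fvec K n \<Longrightarrow> y \<in> fvec K n \<Longrightarrow> bf_eval n B (P x) y = bf_eval n C x (N y)"
begin

abbreviation V where "V \<equiv> fvec K n"
abbreviation b where "b \<equiv> bf_eval n B"
abbreviation c where "c \<equiv> bf_eval n C"

lemma K: "is_subfield K" and char: "CHAR('a) = 2"
  using B.K B.char by auto

text \<open>Since \<open>P\<close> carries isotropic vectors to isotropic vectors, its adjoint
  carries the orthogonal complements the other way.\<close>

lemma N_perp: "s \<in> B.perp B.isotropic \<Longrightarrow> N s \<in> C.perp C.isotropic"
  unfolding B.perp_def C.perp_def B.isotropic_def C.isotropic_def
  using adjoint P_closed N_closed P_norm B.b_sym C.b_sym by (auto; metis)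

lemma minus_eq_plus: "x - y = x + (y :: nat \<Rightarrow> 'a)"
proof
  fix i show "(x - y) i = (x + y) i"
    using char2_add_self[OF char, of "y i"] by (simp add: diff_eq_eq add.assoc)
qed

text \<open>\<open>P (N v) + v\<close> has norm \<open>b v v + b v v = 0\<close>, so
  \<open>y\<close> is orthogonal to it; by adjointness this becomes orthogonality of
  \<open>P (N y) + y\<close> to every \<open>v\<close>.\<close>

lemma P_N_perp:
  assumes y: "y \<in> B.perp B.isotropic"
  shows "P (N y) = y"
proof -
  have yV: "y \<in> V" using y by (simp add: B.perp_def)
  have V2: "P (N v) + v \<in> V" if "v \<in> V" for v
    using that by (intro fvec_closed(2)[OF K] P_closed N_closed)
  have "P (N y) + y = 0"
  proof (rule B.b_nondegenerate)
    show "P (N y) + y \<in> V" using yV by (rule V2)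
    fix v assume v: "v \<in> V"
    have "b (P (N v) + v) (P (N v) + v) = b v v + b v v"
      using v by (simp add: B.b_self_add P_norm N_norm N_closed)
    then have "P (N v) + v \<in> B.isotropic"
      using V2[OF v] char2_add_self[OF char] by (simp add: B.isotropic_def)
    then have "b y (P (N v) + v) = 0" using y by (simp add: B.perp_def)
    moreover have "b (P (N y)) v = b y (P (N v))"
      using v yV by (metis N_closed adjoint C.b_sym B.b_sym)
    ultimately show "b (P (N y) + y) v = 0" by (simp add: bf_eval_linear)
  qed
  then show ?thesis using minus_eq_plus[of "P (N y)" y] by simp
qed

text \<open>\<open>N (P t) + t\<close> is isotropic, so \<open>s\<close> pairs with
  \<open>N (P t)\<close> as it does with \<open>t\<close>.\<close>

lemma P_isometric_perp:
  assumes "s \<in> C.perp C.isotropic" "t \<in> C.perp C.isotropic"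
  shows "b (P s) (P t) = c s t"
proof -
  have V: "s \<in> V" "t \<in> V" using assms by (auto simp: C.perp_def)
  have "N (P t) + t \<in> V" using V by (intro fvec_closed(2)[OF K] P_closed N_closed)
  moreover have "c (N (P t) + t) (N (P t) + t) = c t t + c t t"
    using V by (simp add: C.b_self_add P_norm N_norm P_closed)
  ultimately have "N (P t) + t \<in> C.isotropic"
    using char2_add_self[OF char] by (simp add: C.isotropic_def)
  then have "c s (N (P t) + t) = 0" using assms(1) by (simp add: C.perp_def)
  then have "c s (N (P t)) + c s t = 0" by (simp add: bf_eval_linear)
  then have "c s (N (P t)) + c s t = c s t + c s t" using char2_add_self[OF char, of "c s t"] by simp
  then have "c s (N (P t)) = c s t" by simp
  then show ?thesis using adjoint[OF V(1) P_closed[OF V(2)]] by simp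
qed

definition isometric :: "(nat \<Rightarrow> 'a) \<times> (nat \<Rightarrow> 'a) \<Rightarrow> (nat \<Rightarrow> 'a) \<times> (nat \<Rightarrow> 'a) \<Rightarrow> bool" where
  "isometric g h \<longleftrightarrow> c (fst g) (fst h) = b (snd g) (snd h)"

text \<open>Every isometry agrees with \<open>P\<close> on the orthogonal complement of the isotropic vectors, so the
  extension process of Witt's theorem has to start there.\<close>

definition G0 :: "((nat \<Rightarrow> 'a) \<times> (nat \<Rightarrow> 'a)) set" where
  "G0 = {(s, P s) | s. s \<in> C.perp C.isotropic}"

lemma G0: "lin_rel K n G0" "bi_injective G0" "\<forall>g\<in>G0. \<forall>h\<in>G0. isometric g h"
proof -
  note sub = C.lin_subspace_perp[of C.isotropic, unfolded lin_subspace_def]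
  have P0: "P 0 = 0" using P_add[of 0 0] by simp
  show "lin_rel K n G0"
    unfolding lin_rel_def
  proof (intro conjI allI impI ballI)
    show "G0 \<subseteq> V \<times> V" using sub P_closed unfolding G0_def by blast
    show "(0, 0) \<in> G0" using sub P0 unfolding G0_def by force
  next
    fix x y x' y' assume "(x, y) \<in> G0" "(x', y') \<in> G0"
    then show "(x + x', y + y') \<in> G0" using sub unfolding G0_def by (auto simp: P_add)
  next
    fix t x y assume "t \<in> K" "(x, y) \<in> G0"
    then show "(scal t x, scal t y) \<in> G0" using sub unfolding G0_def by (auto simp: P_scal)
  qed
  \<comment> \<open>If \<open>P s = 0\<close>, then \<open>s\<close> is orthogonal to
    \<open>N (P y)\<close> by adjointness and to the isotropic vector \<open>N (P y) + y\<close>,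
    hence to every \<open>y\<close>.\<close>
  have "s = 0" if s: "s \<in> C.perp C.isotropic" "P s = 0" for s
  proof (rule C.b_nondegenerate)
    show sV: "s \<in> V" using s by (simp add: C.perp_def)
    fix y assume y: "y \<in> V"
    have "N (P y) + y \<in> V" using y by (intro fvec_closed(2)[OF K] P_closed N_closed)
    moreover have "c (N (P y) + y) (N (P y) + y) = c y y + c y y"
      using y by (simp add: C.b_self_add P_norm N_norm P_closed)
    ultimately have "N (P y) + y \<in> C.isotropic"
      using char2_add_self[OF char] by (simp add: C.isotropic_def)
    then have "c s (N (P y) + y) = 0" using s(1) by (simp add: C.perp_def)
    then have "c s (N (P y)) + c s y = 0" by (simp add: bf_eval_linear)
    moreover have "c s (N (P y)) = 0" using adjoint[OF sV P_closed[OF y]] s(2) by (simp add: bf_eval_linear)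
    ultimately show "c s y = 0" by simp
  qed
  then show "bi_injective G0" unfolding bi_injective_def G0_def by (auto simp: P0)
  show "\<forall>g\<in>G0. \<forall>h\<in>G0. isometric g h" unfolding G0_def isometric_def using P_isometric_perp by auto
qed

lemma isometric_adjoin:
  assumes G: "\<forall>g\<in>G. \<forall>h\<in>G. isometric g h" and xy: "c x x = b y y"
    "\<And>z w. (z, w) \<in> G \<Longrightarrow> c z x = b w y"
  shows "\<forall>g\<in>adjoin K G x y. \<forall>h\<in>adjoin K G x y. isometric g h"
proof (intro ballI)
  fix g h assume "g \<in> adjoin K G x y" "h \<in> adjoin K G x y"
  then obtain z w t z' w' t' where *: "g = (z + scal t x, w + scal t y)" "(z, w) \<in> G"
      "h = (z' + scal t' x, w' + scal t' y)" "(z', w') \<in> G" unfolding adjoin_def by blast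
  have "c z z' = b w w'" using G *(2,4) unfolding isometric_def by force
  moreover have "c z x = b w y" "c x z' = b y w'" using xy(2) *(2,4) C.b_sym B.b_sym by metis+
  ultimately show "isometric g h"
    unfolding isometric_def * using xy(1) by (simp add: bf_eval_linear)
qed

text \<open>Any \<open>x\<close> not orthogonal to the radical vector \<open>w\<close> lies outside
  the domain. Its image is sought as \<open>P x + r\<close>: \<open>P x\<close> has the right norm,
  and \<open>r\<close> corrects the products with the range of \<open>G\<close> without disturbing
  the norm.\<close>

lemma isometric_extension_radical:
  assumes G: "lin_rel K n G" "bi_injective G" "\<forall>g\<in>G. \<forall>h\<in>G. isometric g h" "G0 \<subseteq> G"
    and w: "w \<in> Domain G" "w \<noteq> 0" "\<forall>z\<in>Domain G. c w z = 0"
  shows "\<exists>x y. x \<in> V \<and> y \<in> V \<and> x \<notin> Domain G \<and> y \<notin> Range G \<and> c x x = b y y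
    \<and> (\<forall>z w. (z, w) \<in> G \<longrightarrow> c z x = b w y)"
proof -
  have iso: "c z z' = b y y'" if "(z, y) \<in> G" "(z', y') \<in> G" for z z' y y'
    using G(3) that unfolding isometric_def by force
  obtain w' where ww: "(w, w') \<in> G" using w(1) by blast
  obtain x where x: "x \<in> V" "c w x \<noteq> 0"
    using C.b_nondegenerate[of w] w(2) lin_relD(1)[OF G(1) ww] by blast
  have xG: "x \<notin> Domain G" using w(3) x(2) by blast
  let ?S = "B.perp B.isotropic"
  have S: "s + s' \<in> ?S" "scal t s \<in> ?S" if "s \<in> ?S" "s' \<in> ?S" "t \<in> K" for s s' t
    using B.lin_subspace_perp[of B.isotropic] that unfolding lin_subspace_def by blast+
  have S0: "0 \<in> ?S" using B.lin_subspace_perp[of B.isotropic] unfolding lin_subspace_def by blast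
  \<comment> \<open>The defect of \<open>P x\<close> against the pair \<open>(z, y)\<close>, which
    \<open>b y r\<close> has to make up.\<close>
  let ?l = "\<lambda>z y. c z x - b y (P x)"
  \<comment> \<open>Giving the summand \<open>s\<close> the value 0 makes \<open>r\<close>
    orthogonal to \<open>?S\<close>, hence isotropic.\<close>
  let ?U = "{(y + s, ?l z y) | z y s. (z, y) \<in> G \<and> s \<in> ?S}"
  have "\<exists>r\<in>V. \<forall>u t. (u, t) \<in> ?U \<longrightarrow> t = b u r"
  proof (rule B.b_representable)
    show "u \<in> V \<and> t \<in> K" if "(u, t) \<in> ?U" for u t
    proof -
      obtain z y s where *: "u = y + s" "t = ?l z y" "(z, y) \<in> G" "s \<in> ?S" using \<open>(u, t) \<in> ?U\<close> by blast
      have V: "z \<in> V" "y \<in> V" "s \<in> V" using lin_relD(1,2)[OF G(1) *(3)] *(4) by (auto simp: B.perp_def)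
      show ?thesis unfolding *(1,2)
        using V x(1) P_closed by (auto intro!: fvec_closed(2)[OF K] subfield_diff[OF K] C.b_closed B.b_closed)
    qed
    show "(u + v, t + t') \<in> ?U" if uv: "(u, t) \<in> ?U" "(v, t') \<in> ?U" for u t v t'
    proof -
      obtain z y s where *: "u = y + s" "t = ?l z y" "(z, y) \<in> G" "s \<in> ?S" using uv(1) by blast
      obtain z' y' s' where **: "v = y' + s'" "t' = ?l z' y'" "(z', y') \<in> G" "s' \<in> ?S" using uv(2) by blast
      have "u + v = (y + y') + (s + s')" unfolding * ** by (simp add: ac_simps)
      moreover have "t + t' = ?l (z + z') (y + y')" unfolding * ** by (simp add: bf_eval_linear)
      moreover have "(z + z', y + y') \<in> G" using lin_relD(4)[OF G(1) *(3) **(3)] .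
      moreover have "s + s' \<in> ?S" using S(1)[OF *(4) **(4) subfieldD(1)[OF K]] .
      ultimately show ?thesis by blast
    qed
    show "(scal a u, a * t) \<in> ?U" if a: "a \<in> K" and u: "(u, t) \<in> ?U" for a u t
    proof -
      obtain z y s where *: "u = y + s" "t = ?l z y" "(z, y) \<in> G" "s \<in> ?S" using u by blast
      have "scal a u = scal a y + scal a s" unfolding * by (simp add: fun_eq_iff distrib_left)
      moreover have "a * t = ?l (scal a z) (scal a y)" unfolding * by (simp add: bf_eval_linear right_diff_distrib)
      moreover have "(scal a z, scal a y) \<in> G" using lin_relD(5)[OF G(1) a *(3)] .
      moreover have "scal a s \<in> ?S" using S(2)[OF *(4) *(4) a] .
      ultimately show ?thesis by blast
    qed
    \<comment> \<open>Well-definedness: for \<open>y\<close> in \<open>?S\<close>, the inclusion of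
      \<open>G0\<close> forces \<open>z = N y\<close>, and then the defect vanishes by
      adjointness.\<close>
    show "t = 0" if t: "(0, t) \<in> ?U" for t
    proof -
      obtain z y s where *: "0 = y + s" "t = ?l z y" "(z, y) \<in> G" "s \<in> ?S" using t by blast
      have "y = s" using *(1) minus_eq_plus[of y s] by simp
      then have yS: "y \<in> ?S" using *(4) by simp
      then have yV: "y \<in> V" by (simp add: B.perp_def)
      have "(N y, y) \<in> G0" unfolding G0_def using P_N_perp[OF yS] N_perp[OF yS] by force
      then have "(z - N y, y - y) \<in> G" using lin_rel_diff[OF K G(1) *(3)] G(4) by blast
      then have "z = N y" using bi_injectiveD[OF G(2)] by fastforce
      then have "c z x = b y (P x)" using adjoint[OF x(1) yV] C.b_sym B.b_sym by metis
      then show ?thesis using *(2) by simp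
    qed
  qed
  then obtain r where r: "r \<in> V" "\<And>z y s. (z, y) \<in> G \<Longrightarrow> s \<in> ?S \<Longrightarrow> ?l z y = b (y + s) r" by blast
  have "b s r = 0" if "s \<in> ?S" for s
    using r(2)[OF lin_relD(3)[OF G(1)] that] by (simp add: bf_eval_linear)
  then have rr: "b r r = 0" by (intro B.perp_perp_isotropic[OF r(1)])
  let ?y = "P x + r"
  have cross: "c z x = b y ?y" if "(z, y) \<in> G" for z y
    using r(2)[OF that S0] by (simp add: bf_eval_linear diff_eq_eq add.commute)
  \<comment> \<open>A preimage would be orthogonal to \<open>w\<close>, whereas \<open>w'\<close>
    and \<open>?y\<close> have the prescribed product \<open>c w x \<noteq> 0\<close>.\<close>
  have "?y \<notin> Range G"
  proof
    assume "?y \<in> Range G"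
    then obtain z where z: "(z, ?y) \<in> G" by blast
    have "c w z = 0" using w(3) z by blast
    moreover have "c w z = b w' ?y" using iso[OF ww z] .
    ultimately show False using cross[OF ww] x(2) by simp
  qed
  moreover have "?y \<in> V" using r(1) P_closed[OF x(1)] by (intro fvec_closed(2)[OF K])
  moreover have "c x x = b ?y ?y" using B.b_self_add[of "P x" r] P_norm[OF x(1)] rr by simp
  ultimately show ?thesis using x(1) xG cross by blast
qed

text \<open>Nonzero vectors orthogonal to the domain and to the range can be paired with each other:
  as \<open>G0 \<subseteq> G\<close>, both are orthogonal to the complement of the isotropic vectors
  and so have norm zero. The enlarged domain is degenerate, with \<open>x\<close> in its
  radical.\<close>

lemma isometric_extension_nonsingular:
  assumes G: "lin_rel K n G" "bi_injective G" "\<forall>g\<in>G. \<forall>h\<in>G. isometric g h" "G0 \<subseteq> G"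
    and rad: "\<And>w. w \<in> Domain G \<Longrightarrow> \<forall>z\<in>Domain G. c w z = 0 \<Longrightarrow> w = 0"
    and part: "\<not> V \<subseteq> Domain G"
  shows "\<exists>x y. x \<in> V \<and> y \<in> V \<and> x \<notin> Domain G \<and> y \<notin> Range G \<and> c x x = b y y
    \<and> (\<forall>z w. (z, w) \<in> G \<longrightarrow> c z x = b w y)"
proof -
  have iso: "c z z' = b y y'" if "(z, y) \<in> G" "(z', y') \<in> G" for z z' y y'
    using G(3) that unfolding isometric_def by force
  obtain v where "v \<in> V" "v \<notin> Domain G" using part by blast
  from C.separating_vector[OF lin_subspace_Domain[OF G(1)] this]
  obtain x where x: "x \<in> V" "\<forall>z\<in>Domain G. c z x = 0" "c v x = 1" by blast
  have "\<not> V \<subseteq> Range G" using onto_lin_rel_total[OF K G(1,2)] part by blast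
  then obtain v' where "v' \<in> V" "v' \<notin> Range G" by blast
  from B.separating_vector[OF lin_subspace_Range[OF G(1)] this]
  obtain y where y: "y \<in> V" "\<forall>z\<in>Range G. b z y = 0" "b v' y = 1" by blast
  have "x \<noteq> 0" "y \<noteq> 0" using x(3) y(3) by (auto simp: bf_eval_zero)
  have "\<forall>z\<in>Domain G. c x z = 0" using x(2) C.b_sym by simp
  then have "x \<notin> Domain G" using rad \<open>x \<noteq> 0\<close> by blast
  moreover have "y \<notin> Range G"
  proof
    assume "y \<in> Range G"
    then obtain z where z: "(z, y) \<in> G" by blast
    have "c z z' = 0" if "z' \<in> Domain G" for z'
    proof -
      obtain y' where "(z', y') \<in> G" using \<open>z' \<in> Domain G\<close> by blast
      then show ?thesis using iso[OF z] y(2) B.b_sym by (metis Range.RangeI)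
    qed
    then have "z = 0" using rad z by blast
    then show False using bi_injectiveD[OF G(2) z] \<open>y \<noteq> 0\<close> by simp
  qed
  moreover have "c x x = 0"
  proof (rule C.perp_perp_isotropic[OF x(1)])
    fix s assume "s \<in> C.perp C.isotropic"
    then have "(s, P s) \<in> G" using G(4) unfolding G0_def by blast
    then show "c s x = 0" using x(2) by blast
  qed
  moreover have "b y y = 0"
  proof (rule B.perp_perp_isotropic[OF y(1)])
    fix s assume s: "s \<in> B.perp B.isotropic"
    have "(N s, s) \<in> G0" unfolding G0_def using P_N_perp[OF s] N_perp[OF s] by force
    then show "b s y = 0" using y(2) G(4) by blast
  qed
  moreover have "c z x = b w y" if "(z, w) \<in> G" for z w using x(2) y(2) that by force
  ultimately show ?thesis using x(1) y(1) by metis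
qed

text \<open>Degenerate or not, a proper domain can be enlarged, so a maximal partial isometry
  containing \<open>G0\<close> is total.\<close>

lemma isometry_exists: "\<exists>M. invertible_over K n M \<and> (\<forall>x\<in>V. \<forall>y\<in>V. b (matvec n M x) (matvec n M y) = c x y)"
proof -
  obtain G where G: "lin_rel K n G" "bi_injective G" "\<forall>g\<in>G. \<forall>h\<in>G. isometric g h" "G0 \<subseteq> G"
    and max: "\<And>G'. lin_rel K n G' \<Longrightarrow> bi_injective G' \<Longrightarrow> \<forall>g\<in>G'. \<forall>h\<in>G'. isometric g h \<Longrightarrow> G \<subseteq> G' \<Longrightarrow> G' = G"
    using maximal_lin_rel[OF G0] by blast
  have "V \<subseteq> Domain G"
  proof (rule ccontr)
    assume part: "\<not> V \<subseteq> Domain G"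
    have "\<exists>x y. x \<in> V \<and> y \<in> V \<and> x \<notin> Domain G \<and> y \<notin> Range G \<and> c x x = b y y
      \<and> (\<forall>z w. (z, w) \<in> G \<longrightarrow> c z x = b w y)"
    proof (cases "\<exists>w\<in>Domain G. w \<noteq> 0 \<and> (\<forall>z\<in>Domain G. c w z = 0)")
      case True
      then show ?thesis using isometric_extension_radical[OF G] by (elim bexE conjE)
    next
      case False
      then show ?thesis by (intro isometric_extension_nonsingular[OF G _ part]) blast
    qed
    then obtain x y where xy: "x \<in> V" "y \<in> V" "x \<notin> Domain G" "y \<notin> Range G" "c x x = b y y"
      "\<And>z w. (z, w) \<in> G \<Longrightarrow> c z x = b w y" by blast
    have "adjoin K G x y = G"
      using lin_rel_adjoin[OF K G(1) xy(1,2)] bi_injective_adjoin[OF K G(1,2) xy(3,4)]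
        isometric_adjoin[OF G(3) xy(5,6)] by (intro max)
    then show False using lin_rel_adjoin(3)[OF K G(1) xy(1,2)] xy(3) by blast
  qed
  from total_lin_rel_matrix[OF K G(1,2) this]
  obtain M where M: "invertible_over K n M" "\<forall>x\<in>V. (x, matvec n M x) \<in> G" by blast
  have "b (matvec n M x) (matvec n M y) = c x y" if xy: "x \<in> V" "y \<in> V" for x y
  proof -
    have "isometric (x, matvec n M x) (y, matvec n M y)" using G(3) M(2) xy by blast
    then show ?thesis by (simp add: isometric_def)
  qed
  then show ?thesis using M(1) by blast
qed

end

text \<open>\<open>P\<close> and \<open>N\<close> say that both forms take the same values. By
  maximality, no vector outside the domain shares its value with one outside the range. So any
  \<open>v\<close> outside the domain differs from an element of the domain by a vector of value 0,
  and likewise for \<open>w\<close> and the range; these two differences could be paired.\<close>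

lemma quasilinear_isometry_exists:
  fixes q q' :: "(nat \<Rightarrow> 'a::field) \<Rightarrow> 'a"
  assumes K: "is_subfield K"
    and q: "\<And>x y. q (x + y) = q x + q y" "\<And>t x. q (scal t x) = t ^ 2 * q x"
    and q': "\<And>x y. q' (x + y) = q' x + q' y" "\<And>t x. q' (scal t x) = t ^ 2 * q' x"
    and P: "\<And>x. x \<in> fvec K n \<Longrightarrow> P x \<in> fvec K n \<and> q (P x) = q' x"
    and N: "\<And>x. x \<in> fvec K n \<Longrightarrow> N x \<in> fvec K n \<and> q' (N x) = q x"
  shows "\<exists>M. invertible_over K n M \<and> (\<forall>x\<in>fvec K n. q (matvec n M x) = q' x)"
proof -
  let ?V = "fvec K n"
  let ?Q = "\<lambda>g h. q' (fst g) = q (snd g)"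
  have diff: "q (x - y) = q x - q y" "q' (x - y) = q' x - q' y" for x y
    using q(1)[of "x - y" y] q'(1)[of "x - y" y] by simp_all
  have "q 0 = 0" "q' 0 = 0" using diff[of 0 0] by simp_all
  have scal0: "scal t 0 = 0" for t :: 'a by (simp add: fun_eq_iff)
  have "lin_rel K n {(0, 0)}"
    unfolding lin_rel_def using fvec_closed(1)[OF K] scal0 by auto
  moreover have "bi_injective {(0 :: nat \<Rightarrow> 'a, 0 :: nat \<Rightarrow> 'a)}" by (simp add: bi_injective_def)
  moreover have "\<forall>g\<in>{(0, 0)}. \<forall>h\<in>{(0, 0)}. ?Q g h" using \<open>q 0 = 0\<close> \<open>q' 0 = 0\<close> by simp
  ultimately obtain G where G: "lin_rel K n G" "bi_injective G" "\<forall>g\<in>G. \<forall>h\<in>G. ?Q g h"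
    and max: "\<And>G'. lin_rel K n G' \<Longrightarrow> bi_injective G' \<Longrightarrow> \<forall>g\<in>G'. \<forall>h\<in>G'. ?Q g h \<Longrightarrow> G \<subseteq> G' \<Longrightarrow> G' = G"
    using maximal_lin_rel[of K n "{(0, 0)}" ?Q] by blast
  have iso: "q' x = q y" if "(x, y) \<in> G" for x y using G(3) that by force
  have no_ext: "x \<in> Domain G \<or> y \<in> Range G" if xy: "x \<in> ?V" "y \<in> ?V" "q' x = q y" for x y
  proof (rule ccontr)
    assume "\<not> (x \<in> Domain G \<or> y \<in> Range G)"
    then have not: "x \<notin> Domain G" "y \<notin> Range G" by auto
    have "\<forall>g\<in>adjoin K G x y. \<forall>h\<in>adjoin K G x y. ?Q g h"
      unfolding adjoin_def using iso xy(3) q q' by auto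
    then have "adjoin K G x y = G"
      using lin_rel_adjoin[OF K G(1) xy(1,2)] bi_injective_adjoin[OF K G(1,2) not] by (intro max)
    then show False using lin_rel_adjoin(3)[OF K G(1) xy(1,2)] not(1) by blast
  qed
  have "?V \<subseteq> Domain G"
  proof (rule ccontr)
    assume part: "\<not> ?V \<subseteq> Domain G"
    then obtain v where v: "v \<in> ?V" "v \<notin> Domain G" by blast
    have "\<not> ?V \<subseteq> Range G" using onto_lin_rel_total[OF K G(1,2)] part by blast
    then obtain w where w: "w \<in> ?V" "w \<notin> Range G" by blast
    have "N w \<in> Domain G" using no_ext[of "N w" w] N[OF w(1)] w by blast
    then obtain y where y: "(N w, y) \<in> G" by blast
    have "P v \<in> Range G" using no_ext[of v "P v"] P[OF v(1)] v by auto
    then obtain z where z: "(z, P v) \<in> G" by blast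
    have "q' (v - z) = 0" using iso[OF z] P[OF v(1)] diff by simp
    moreover have "q (w - y) = 0" using iso[OF y] N[OF w(1)] diff by simp
    moreover have "v - z \<in> ?V" "w - y \<in> ?V"
      using v w lin_relD(1)[OF G(1) z] lin_relD(2)[OF G(1) y] by (auto intro: fvec_closed(3)[OF K])
    ultimately have "v - z \<in> Domain G \<or> w - y \<in> Range G" using no_ext by simp
    then show False
    proof
      assume "v - z \<in> Domain G"
      then obtain u where "(v - z, u) \<in> G" by blast
      from lin_relD(4)[OF G(1) this z] have "(v, u + P v) \<in> G" by simp
      then show False using v(2) by blast
    next
      assume "w - y \<in> Range G"
      then obtain u where "(u, w - y) \<in> G" by blast
      from lin_relD(4)[OF G(1) this y] have "(u + N w, w) \<in> G" by simp
      then show False using w(2) by blast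
    qed
  qed
  from total_lin_rel_matrix[OF K G(1,2) this]
  obtain M where "invertible_over K n M" "\<forall>x\<in>?V. (x, matvec n M x) \<in> G" by blast
  then show ?thesis using iso by metis
qed

section \<open>Diagonal forms\<close>

text \<open>Common to both cases: the value of a totally singular form, and the norm
  \<open>B(x,x)\<close> of a symmetric bilinear form in characteristic 2.\<close>

definition dq :: "nat \<Rightarrow> (nat \<Rightarrow> nat \<Rightarrow> 'a::comm_ring_1) \<Rightarrow> (nat \<Rightarrow> 'a) \<Rightarrow> 'a" where
  "dq n a x = (\<Sum>i<n. a i i * x i ^ 2)"

lemma dq_add:
  fixes a :: "nat \<Rightarrow> nat \<Rightarrow> 'a::field"
  shows "CHAR('a) = 2 \<Longrightarrow> dq n a (x + y) = dq n a x + dq n a y"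
  by (simp add: dq_def char2_square_add distrib_left sum.distrib)

lemma dq_scal: "dq n a (scal t x) = t ^ 2 * dq n a x"
  by (simp add: dq_def power_mult_distrib sum_distrib_left ac_simps)

lemma dq_cong: "(\<And>i. i < n \<Longrightarrow> x i = y i) \<Longrightarrow> dq n a x = dq n a y"
  by (simp add: dq_def)

lemma dq_unitv: "k < n \<Longrightarrow> dq n a (unitv k) = a k k"
proof -
  assume k: "k < n"
  have "dq n a (unitv k) = (\<Sum>i<n. if i = k then a i i else 0)"
    unfolding dq_def unitv_def by (intro sum.cong) auto
  then show ?thesis using k by simp
qed

lemma dq_matvec:
  fixes a :: "nat \<Rightarrow> nat \<Rightarrow> 'a::field"
  assumes "CHAR('a) = 2"
  shows "dq n a (matvec n M x) = (\<Sum>j<n. dq n a (\<lambda>i. M i j) * x j ^ 2)"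
proof -
  have "dq n a (matvec n M x) = (\<Sum>i<n. \<Sum>j<n. a i i * M i j ^ 2 * x j ^ 2)"
    by (simp add: dq_def matvec_def char2_square_sum[OF assms] sum_distrib_left power_mult_distrib mult.assoc)
  also have "\<dots> = (\<Sum>j<n. \<Sum>i<n. a i i * M i j ^ 2 * x j ^ 2)" by (rule sum.swap)
  finally show ?thesis by (simp add: dq_def sum_distrib_right)
qed

lemma sum_symmetric_char2:
  fixes g :: "nat \<Rightarrow> nat \<Rightarrow> 'a::field"
  assumes "CHAR('a) = 2" "\<And>i j. i < n \<Longrightarrow> j < n \<Longrightarrow> g i j = g j i"
  shows "(\<Sum>i<n. \<Sum>j<n. g i j) = (\<Sum>i<n. g i i)"
  using assms(2)
proof (induction n)
  case (Suc n)
  have "(\<Sum>i<Suc n. \<Sum>j<Suc n. g i j)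
    = (\<Sum>i<n. \<Sum>j<n. g i j) + (\<Sum>i<n. g i n) + (\<Sum>j<n. g n j) + g n n"
    by (simp add: sum.distrib)
  moreover have "(\<Sum>i<n. g i n) = (\<Sum>j<n. g n j)" using Suc.prems by (intro sum.cong) auto
  moreover have "(\<Sum>i<n. \<Sum>j<n. g i j) = (\<Sum>i<n. g i i)" using Suc by simp
  ultimately show ?case using char2_add_self[OF assms(1), of "\<Sum>j<n. g n j"] by (simp add: add.assoc)
qed simp

lemma bf_eval_diag:
  fixes B :: "nat \<Rightarrow> nat \<Rightarrow> 'a::field"
  assumes "CHAR('a) = 2" "\<forall>i<n. \<forall>j<n. B i j = B j i"
  shows "bf_eval n B x x = dq n B x"
  unfolding bf_eval_def dq_def
  by (subst sum_symmetric_char2[OF assms(1)]) (use assms(2) in \<open>auto simp: power2_eq_square ac_simps\<close>)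

lemma bf_eval_cong: "(\<And>i. i < n \<Longrightarrow> x i = x' i) \<Longrightarrow> (\<And>i. i < n \<Longrightarrow> y i = y' i) \<Longrightarrow> bf_eval n B x y = bf_eval n B x' y'"
  by (simp add: bf_eval_def)

lemma bf_eval_unitv_right: "k < n \<Longrightarrow> bf_eval n B x (unitv k) = (\<Sum>i<n. B i k * x i)"
proof -
  assume k: "k < n"
  have "(\<Sum>j<n. B i j * x i * unitv k j) = B i k * x i" for i
  proof -
    have "(\<Sum>j<n. B i j * x i * unitv k j) = (\<Sum>j<n. if j = k then B i j * x i else 0)"
      unfolding unitv_def by (intro sum.cong) auto
    then show ?thesis using k by simp
  qed
  then show ?thesis by (simp add: bf_eval_def)
qed

lemma bf_eval_unitv_left: "k < n \<Longrightarrow> bf_eval n B (unitv k) x = (\<Sum>i<n. B k i * x i)"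
proof -
  assume k: "k < n"
  have "bf_eval n B (unitv k) x = (\<Sum>i<n. if i = k then (\<Sum>j<n. B i j * x j) else 0)"
    unfolding bf_eval_def unitv_def by (intro sum.cong) auto
  then show ?thesis using k by simp
qed

lemma bf_eval_unitv: "i < n \<Longrightarrow> j < n \<Longrightarrow> bf_eval n B (unitv i) (unitv j) = B i j"
proof -
  assume ij: "i < n" "j < n"
  have "(\<Sum>k<n. B i k * unitv j k) = (\<Sum>k<n. if k = j then B i k else 0)"
    unfolding unitv_def by (intro sum.cong) auto
  then show ?thesis using ij by (simp add: bf_eval_unitv_left)
qed

lemma bf_eval_factor: "bf_eval n (\<lambda>i j. t * B i j) x y = t * bf_eval n B x y"
  by (simp add: bf_eval_def sum_distrib_left ac_simps)

lemma bf_eval_matvec_left: "bf_eval n B (matvec n M x) y = bf_eval n (\<lambda>i j. \<Sum>k<n. B k j * M k i) x y"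
proof -
  have "bf_eval n B (matvec n M x) y = (\<Sum>k<n. \<Sum>j<n. \<Sum>i<n. B k j * M k i * x i * y j)"
    by (simp add: bf_eval_def matvec_def sum_distrib_left sum_distrib_right ac_simps)
  also have "\<dots> = (\<Sum>k<n. \<Sum>i<n. \<Sum>j<n. B k j * M k i * x i * y j)"
    by (intro sum.cong refl sum.swap)
  also have "\<dots> = (\<Sum>i<n. \<Sum>k<n. \<Sum>j<n. B k j * M k i * x i * y j)" by (rule sum.swap)
  also have "\<dots> = (\<Sum>i<n. \<Sum>j<n. \<Sum>k<n. B k j * M k i * x i * y j)"
    by (intro sum.cong refl sum.swap)
  finally show ?thesis by (simp add: bf_eval_def sum_distrib_right)
qed

lemma bf_eval_matvec_right: "bf_eval n B x (matvec n M y) = bf_eval n (\<lambda>i j. \<Sum>k<n. B i k * M k j) x y"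
proof -
  have "bf_eval n B x (matvec n M y) = (\<Sum>i<n. \<Sum>k<n. \<Sum>j<n. B i k * M k j * x i * y j)"
    by (simp add: bf_eval_def matvec_def sum_distrib_left sum_distrib_right ac_simps)
  also have "\<dots> = (\<Sum>i<n. \<Sum>j<n. \<Sum>k<n. B i k * M k j * x i * y j)"
    by (intro sum.cong refl sum.swap)
  finally show ?thesis by (simp add: bf_eval_def sum_distrib_right)
qed

lemma bf_eval_matrix_cong:
  "(\<And>i j. i < n \<Longrightarrow> j < n \<Longrightarrow> B i j = C i j) \<Longrightarrow> bf_eval n B x y = bf_eval n C x y"
  by (simp add: bf_eval_def)

lemma qf_eval_unitv:
  fixes d :: "nat \<Rightarrow> nat \<Rightarrow> 'a::comm_ring_1"
  assumes "i < n" "j < n"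
  shows "(\<Sum>k<n. \<Sum>l\<in>{k..<n}. d k l * unitv i k * unitv j l) = (if i \<le> j then d i j else 0)"
proof -
  have "(\<Sum>l\<in>{k..<n}. d k l * unitv i k * unitv j l) = (if k = i then (if k \<le> j then d k j else 0) else 0)" for k
  proof -
    have "(\<Sum>l\<in>{k..<n}. d k l * unitv i k * unitv j l) = (\<Sum>l\<in>{k..<n}. if l = j then (if k = i then d k l else 0) else 0)"
      unfolding unitv_def by (intro sum.cong) auto
    then show ?thesis using assms(2) by simp
  qed
  then show ?thesis using assms(1) by simp
qed

text \<open>A form isometric to a diagonal one is additive in characteristic 2, and its value at
  \<open>unitv i + unitv j\<close> then shows \<open>d i j = 0\<close> for \<open>i < j\<close>. The
  identity holds at all vectors, not only those over \<open>K\<close>, and so passes to the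
  extension.\<close>

lemma totally_singular_eval:
  fixes d :: "nat \<Rightarrow> nat \<Rightarrow> 'a::field"
  assumes char: "CHAR('a) = 2" and K: "is_subfield K" and ts: "totally_singular_qf K n d"
  shows "qf_eval n d x = dq n d x"
proof -
  obtain a M where M: "invertible_over K n M"
    and ev: "\<And>x. vec_in K n x \<Longrightarrow> qf_eval n d (matvec n M x) = qf_eval n (diag_qf a) x"
    using ts unfolding totally_singular_qf_def qf_iso_def by blast
  obtain N where N: "mat_in K n N" "\<forall>i<n. \<forall>k<n. (\<Sum>j<n. M i j * N j k) = (if i = k then 1 else 0)"
    using M unfolding invertible_over_def by blast
  have diagsum: "(\<Sum>j\<in>{i..<n}. e i j * x i * x j) = e i i * x i ^ 2"
    if "i < n" "\<And>j. i < j \<Longrightarrow> j < n \<Longrightarrow> e i j = 0" for e :: "nat \<Rightarrow> nat \<Rightarrow> 'a" and x i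
  proof -
    have "(\<Sum>j\<in>{i..<n}. e i j * x i * x j) = (\<Sum>j\<in>{i..<n}. if j = i then e i j * x i * x j else 0)"
      using that(2) by (intro sum.cong) auto
    then show ?thesis using that(1) by (simp add: power2_eq_square)
  qed
  have diag: "qf_eval n (diag_qf a) x = dq n (diag_qf a) x" for x
    unfolding qf_eval_def dq_def by (intro sum.cong refl diagsum) (auto simp: diag_qf_def)
  have eval_cong: "qf_eval n d u = qf_eval n d v" if "\<And>i. i < n \<Longrightarrow> u i = v i" for u v
    unfolding qf_eval_def using that by (intro sum.cong refl) auto
  have inv: "qf_eval n d u = dq n (diag_qf a) (matvec n N u)" if u: "vec_in K n u" for u
  proof -
    have "vec_in K n (matvec n N u)" using u N(1)
      by (auto simp: vec_in_def matvec_def mat_in_def intro!: subfield_sum[OF K] subfieldD(4)[OF K])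
    from ev[OF this] have "qf_eval n d (matvec n M (matvec n N u)) = dq n (diag_qf a) (matvec n N u)"
      unfolding diag .
    then show ?thesis using eval_cong[of "matvec n M (matvec n N u)" u] matvec_inverse[OF N(2)] by simp
  qed
  have off: "d i j = 0" if ij: "i < j" "j < n" for i j
  proof -
    have inn: "i < n" using ij by simp
    have uK: "vec_in K n (unitv k)" for k by (auto simp: vec_in_def unitv_def subfieldD[OF K])
    then have uvK: "vec_in K n (unitv i + unitv j)" by (auto simp: vec_in_def subfieldD[OF K])
    have Nadd: "matvec n N (unitv i + unitv j) = matvec n N (unitv i) + matvec n N (unitv j)"
      by (simp add: matvec_def fun_eq_iff distrib_left sum.distrib)
    have "qf_eval n d (unitv i + unitv j) = qf_eval n d (unitv i) + qf_eval n d (unitv j)"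
      unfolding inv[OF uK] inv[OF uvK] Nadd by (rule dq_add[OF char])
    moreover have "qf_eval n d (unitv i + unitv j) = qf_eval n d (unitv i) + qf_eval n d (unitv j)
      + (\<Sum>k<n. \<Sum>l\<in>{k..<n}. d k l * unitv i k * unitv j l)
      + (\<Sum>k<n. \<Sum>l\<in>{k..<n}. d k l * unitv j k * unitv i l)"
      by (simp add: qf_eval_def sum.distrib[symmetric] algebra_simps)
    ultimately show ?thesis
      unfolding qf_eval_unitv[OF inn ij(2)] qf_eval_unitv[OF ij(2) inn] using ij by simp
  qed
  show ?thesis
    unfolding qf_eval_def dq_def using off by (intro sum.cong refl diagsum) auto
qed

section \<open>Descent of similarities\<close>

text \<open>By additivity the norm equations reduce to one per column, and \<open>mu\<close> sends
  each to the same equation for the entries \<open>lam (M i j)\<close> with factor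
  \<open>mu c\<close>. The adjoint relation is a conditional part so that the lemma also serves
  quadratic forms, whose coefficients below the diagonal are arbitrary.\<close>

lemma similarity_descends:
  fixes F :: "'a::field set"
  assumes char: "CHAR('a) = 2" and sep: "separable_algebraic_ext F"
    and diag: "\<forall>i<n. phi i i \<in> F \<and> psi i i \<in> F" and c: "c \<noteq> 0"
    and inv: "\<forall>i<n. \<forall>k<n. (\<Sum>j<n. M i j * N j k) = (if i = k then 1 else 0)"
    and ev: "\<And>x. dq n phi (matvec n M x) = c * dq n psi x"
  shows "\<exists>f P Q. f \<in> F \<and> f \<noteq> 0 \<and> mat_in F n P \<and> mat_in F n Q
    \<and> (\<forall>j<n. dq n phi (\<lambda>i. P i j) = f * psi j j) \<and> (\<forall>j<n. dq n psi (\<lambda>i. Q i j) = f * phi j j)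
    \<and> (mat_in F n phi \<longrightarrow> mat_in F n psi \<longrightarrow>
        (\<forall>i<n. \<forall>j<n. (\<Sum>k<n. phi k j * M k i) = (\<Sum>k<n. psi i k * (c * N k j))) \<longrightarrow>
        (\<forall>i<n. \<forall>j<n. (\<Sum>k<n. phi k j * P k i) = (\<Sum>k<n. psi i k * Q k j)))"
proof -
  have F: "is_subfield F" using sep by (simp add: separable_algebraic_ext_def)
  let ?I = "{..<n} \<times> {..<n}"
  \<comment> \<open>\<open>c\<close> and all entries to which the functionals will be
    applied.\<close>
  let ?S = "insert c ((\<lambda>(i, j). M i j) ` ?I \<union> (\<lambda>(i, j). c * N i j) ` ?I)"
  have "finite ?S" "c \<in> ?S" by auto
  from frobenius_compatible_functionals[OF char sep this c]
  obtain A lam mu where S: "?S \<subseteq> A" and FA: "F \<subseteq> A"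
    and add: "\<forall>u\<in>A. \<forall>v\<in>A. u + v \<in> A \<and> u * v \<in> A \<and> lam (u + v) = lam u + lam v \<and> mu (u + v) = mu u + mu v"
    and scl: "\<forall>t\<in>F. \<forall>u\<in>A. lam (t * u) = t * lam u \<and> mu (t * u) = t * mu u"
    and val: "\<forall>u\<in>A. lam u \<in> F \<and> mu u \<in> F \<and> mu (u ^ 2) = lam u ^ 2" and nz: "mu c \<noteq> 0"
    by (elim exE conjE)
  have A0: "0 \<in> A" using FA subfieldD(1)[OF F] by blast
  have lam0: "lam 0 = 0" "mu 0 = 0" using scl subfieldD(1)[OF F] A0 by (metis mult_zero_left)+
  have lin: "(\<Sum>i<m. t i * u i) \<in> A \<and> lam (\<Sum>i<m. t i * u i) = (\<Sum>i<m. t i * lam (u i))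
      \<and> mu (\<Sum>i<m. t i * u i) = (\<Sum>i<m. t i * mu (u i))"
    if "\<And>i. i < m \<Longrightarrow> t i \<in> F" "\<And>i. i < m \<Longrightarrow> u i \<in> A" for m :: nat and t u
    using that
  proof (induction m)
    case (Suc m)
    have "t m \<in> F" "u m \<in> A" using Suc.prems by auto
    then have "t m * u m \<in> A" "lam (t m * u m) = t m * lam (u m)" "mu (t m * u m) = t m * mu (u m)"
      using add FA scl by auto
    then show ?case using Suc add by auto
  qed (simp add: A0 lam0)
  have cA: "c \<in> A" using S by simp
  have MA: "M i j \<in> A" "c * N i j \<in> A" if "i < n" "j < n" for i j
  proof -
    have "(i, j) \<in> ?I" using that by simp
    then have "M i j \<in> ?S" "c * N i j \<in> ?S" by (auto intro: rev_image_eqI)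
    then show "M i j \<in> A" "c * N i j \<in> A" using S by blast+
  qed
  have square: "dq n a (\<lambda>i. lam (u i)) = mu c * b"
    if "\<And>i. i < n \<Longrightarrow> a i i \<in> F" "\<And>i. i < n \<Longrightarrow> u i \<in> A" "b \<in> F" "dq n a u = c * b" for a u b
  proof -
    have sqA: "u i ^ 2 \<in> A" if "i < n" for i using \<open>\<And>i. i < n \<Longrightarrow> u i \<in> A\<close> that add by (simp add: power2_eq_square)
    have "dq n a (\<lambda>i. lam (u i)) = (\<Sum>i<n. a i i * mu (u i ^ 2))"
      unfolding dq_def using that(2) val by (intro sum.cong) auto
    also have "\<dots> = mu (\<Sum>i<n. a i i * u i ^ 2)" using lin[of n "\<lambda>i. a i i" "\<lambda>i. u i ^ 2"] that(1) sqA by auto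
    also have "\<dots> = mu (b * c)" using that(4) by (simp add: dq_def mult.commute)
    also have "\<dots> = mu c * b" using scl that(3) cA by (simp add: mult.commute)
    finally show ?thesis .
  qed
  have col: "dq n phi (\<lambda>i. M i j) = c * psi j j" if "j < n" for j
    using ev[of "unitv j"] by (simp add: matvec_unitv[OF that] dq_unitv[OF that])
  \<comment> \<open>The equation for \<open>M\<close>, evaluated at column \<open>j\<close> of
    \<open>c * N\<close>, gives \<open>c * c * phi j j\<close>; cancelling one \<open>c\<close>
    yields the mirrored equation.\<close>
  have col': "dq n psi (\<lambda>i. c * N i j) = c * phi j j" if j: "j < n" for j
  proof -
    have "matvec n N (scal c (unitv j)) = (\<lambda>i. c * N i j)"
    proof
      fix i
      have "matvec n N (scal c (unitv j)) i = c * matvec n N (unitv j) i"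
        by (simp add: matvec_def sum_distrib_left ac_simps)
      then show "matvec n N (scal c (unitv j)) i = c * N i j" by (simp add: matvec_unitv[OF j])
    qed
    then have "c * dq n psi (\<lambda>i. c * N i j) = dq n phi (matvec n M (matvec n N (scal c (unitv j))))"
      using ev by simp
    also have "\<dots> = dq n phi (scal c (unitv j))"
      by (intro dq_cong matvec_inverse[OF inv])
    also have "\<dots> = c * (c * phi j j)" by (simp add: dq_scal dq_unitv[OF j] power2_eq_square)
    finally show ?thesis using c by simp
  qed
  define P where "P = (\<lambda>i j. lam (M i j))"
  define Q where "Q = (\<lambda>i j. lam (c * N i j))"
  show ?thesis
  proof (rule exI[of _ "mu c"], rule exI[of _ P], rule exI[of _ Q], intro conjI impI allI)
    show "mu c \<in> F" using val cA by blast
    show "mat_in F n P" "mat_in F n Q" using val MA by (auto simp: mat_in_def P_def Q_def)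
    show "dq n phi (\<lambda>i. P i j) = mu c * psi j j" if "j < n" for j
      unfolding P_def using that MA col diag by (intro square) auto
    show "dq n psi (\<lambda>i. Q i j) = mu c * phi j j" if "j < n" for j
      unfolding Q_def using that MA col' diag by (intro square) auto
    fix i j
    assume mats: "mat_in F n phi" "mat_in F n psi" and ij: "i < n" "j < n"
      and adj: "\<forall>i<n. \<forall>j<n. (\<Sum>k<n. phi k j * M k i) = (\<Sum>k<n. psi i k * (c * N k j))"
    have "(\<Sum>k<n. phi k j * P k i) = lam (\<Sum>k<n. phi k j * M k i)"
      unfolding P_def using lin[of n "\<lambda>k. phi k j" "\<lambda>k. M k i"] mats ij MA by (auto simp: mat_in_def)
    also have "\<dots> = lam (\<Sum>k<n. psi i k * (c * N k j))" using adj ij by simp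
    also have "\<dots> = (\<Sum>k<n. psi i k * Q k j)"
      unfolding Q_def using lin[of n "\<lambda>k. psi i k" "\<lambda>k. c * N k j"] mats ij MA by (auto simp: mat_in_def)
    finally show "(\<Sum>k<n. phi k j * P k i) = (\<Sum>k<n. psi i k * Q k j)" .
  qed (rule nz)
qed

text \<open>Passes from \<open>vec_in\<close>, which leaves entries from \<open>n\<close> on free,
  to \<open>fvec\<close>.\<close>

definition trunc :: "nat \<Rightarrow> (nat \<Rightarrow> 'a::zero) \<Rightarrow> nat \<Rightarrow> 'a" where
  "trunc n x = (\<lambda>i. if i < n then x i else 0)"

lemma trunc_eq [simp]: "i < n \<Longrightarrow> trunc n x i = x i"
  by (simp add: trunc_def)

lemma trunc_in_fvec: "vec_in K n x \<Longrightarrow> trunc n x \<in> fvec K n"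
  by (auto simp: vec_in_def fvec_def trunc_def)

lemma matvec_trunc: "matvec n M (trunc n x) = matvec n M x"
  by (simp add: matvec_def fun_eq_iff)

lemma vec_in_matvec: "is_subfield K \<Longrightarrow> mat_in K n M \<Longrightarrow> x \<in> fvec K n \<Longrightarrow> vec_in K n (matvec n M x)"
  by (auto simp: vec_in_def matvec_def mat_in_def fvec_def intro!: subfield_sum subfieldD(4))

lemma dq_matvec_columns:
  fixes a :: "nat \<Rightarrow> nat \<Rightarrow> 'a::field"
  assumes "CHAR('a) = 2" "\<And>j. j < n \<Longrightarrow> dq n a (\<lambda>i. M i j) = t * b j j"
  shows "dq n a (matvec n M x) = t * dq n b x"
  unfolding dq_matvec[OF assms(1)] using assms(2) by (simp add: dq_def[of n b] sum_distrib_left mult.assoc)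

lemma invertible_over_UNIV: "invertible_over K n M \<Longrightarrow> invertible_over UNIV n M"
  unfolding invertible_over_def mat_in_def by (elim conjE exE) (intro conjI exI; simp)

text \<open>The isometry is given only at vectors over \<open>K\<close>, but both sides are diagonal
  forms, determined by their values at the unit vectors.\<close>

lemma qf_similar_extend:
  fixes K :: "'a::field set"
  assumes char: "CHAR('a) = 2" and K: "is_subfield K"
    and ts: "totally_singular_qf K m phi" "totally_singular_qf K n psi" and sim: "qf_similar K m phi n psi"
  shows "qf_similar UNIV m phi n psi"
proof -
  obtain t M where t: "t \<noteq> 0" "m = n" and M: "invertible_over K n M"
    and ev: "\<And>x. vec_in K n x \<Longrightarrow> qf_eval n phi (matvec n M x) = qf_eval n (\<lambda>i j. t * psi i j) x"
    using sim unfolding qf_similar_def qf_iso_def by blast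
  note phi = totally_singular_eval[OF char K ts(1)[unfolded t(2)]]
  have psi: "qf_eval n (\<lambda>i j. t * psi i j) x = t * dq n psi x" for x
    unfolding totally_singular_eval[OF char K ts(2), symmetric]
    by (simp add: qf_eval_def sum_distrib_left ac_simps)
  have "dq n phi (\<lambda>i. M i j) = t * psi j j" if "j < n" for j
  proof -
    have "vec_in K n (unitv j)" by (auto simp: vec_in_def unitv_def subfieldD[OF K])
    from ev[OF this] show ?thesis by (simp add: phi psi matvec_unitv[OF that] dq_unitv[OF that])
  qed
  then have "qf_eval n phi (matvec n M x) = qf_eval n (\<lambda>i j. t * psi i j) x" for x
    unfolding phi psi by (intro dq_matvec_columns[OF char]) auto
  then show ?thesis
    unfolding qf_similar_def qf_iso_def using t invertible_over_UNIV[OF M] by blast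
qed

lemma qf_similar_descend:
  fixes F :: "'a::field set"
  assumes char: "CHAR('a) = 2" and sep: "separable_algebraic_ext F"
    and ts: "totally_singular_qf F m phi" "totally_singular_qf F n psi" and sim: "qf_similar UNIV m phi n psi"
  shows "qf_similar F m phi n psi"
proof -
  have F: "is_subfield F" using sep by (simp add: separable_algebraic_ext_def)
  obtain c M where c: "c \<noteq> 0" "m = n" and M: "invertible_over UNIV n M"
    and ev: "\<And>x. qf_eval n phi (matvec n M x) = qf_eval n (\<lambda>i j. c * psi i j) x"
    using sim unfolding qf_similar_def qf_iso_def vec_in_def by blast
  note ts' = ts(1)[unfolded c(2)] ts(2)
  note phi = totally_singular_eval[OF char F ts'(1)]
  have psi: "qf_eval n (\<lambda>i j. t * psi i j) x = t * dq n psi x" for t x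
    unfolding totally_singular_eval[OF char F ts'(2), symmetric]
    by (simp add: qf_eval_def sum_distrib_left ac_simps)
  obtain N where N: "\<forall>i<n. \<forall>k<n. (\<Sum>j<n. M i j * N j k) = (if i = k then 1 else 0)"
    using M unfolding invertible_over_def by blast
  have "is_qf F n phi" "is_qf F n psi" using ts' by (simp_all add: totally_singular_qf_def)
  then have "\<forall>i<n. phi i i \<in> F \<and> psi i i \<in> F" by (simp add: is_qf_def)
  from similarity_descends[OF char sep this c(1) N ev[unfolded phi psi]]
  obtain f P Q where f: "f \<in> F" "f \<noteq> 0" and PQ: "mat_in F n P" "mat_in F n Q"
    and P': "\<forall>j<n. dq n phi (\<lambda>i. P i j) = f * psi j j"
    and Q': "\<forall>j<n. dq n psi (\<lambda>i. Q i j) = f * phi j j" by (elim exE conjE)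
  have P: "dq n phi (matvec n P x) = f * dq n psi x" for x
    using P' by (intro dq_matvec_columns[OF char]) auto
  have Q: "dq n psi (matvec n Q x) = f * dq n phi x" for x
    using Q' by (intro dq_matvec_columns[OF char]) auto
  let ?q' = "\<lambda>x. f * dq n psi x"
  have "\<exists>M. invertible_over F n M \<and> (\<forall>x\<in>fvec F n. dq n phi (matvec n M x) = ?q' x)"
  proof (rule quasilinear_isometry_exists[OF F dq_add[OF char] dq_scal])
    show "?q' (x + y) = ?q' x + ?q' y" for x y by (simp add: dq_add[OF char] distrib_left)
    show "?q' (scal t x) = t ^ 2 * ?q' x" for t x by (simp add: dq_scal)
    fix x assume x: "x \<in> fvec F n"
    have "dq n phi (trunc n (matvec n P x)) = dq n phi (matvec n P x)" by (rule dq_cong) simp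
    then show "trunc n (matvec n P x) \<in> fvec F n \<and> dq n phi (trunc n (matvec n P x)) = ?q' x"
      using trunc_in_fvec[OF vec_in_matvec[OF F PQ(1) x]] P by simp
    \<comment> \<open>The scaling gives \<open>?q'\<close> the value
      \<open>f * inverse f ^ 2 * f = 1\<close> times \<open>dq n phi x\<close>.\<close>
    let ?y = "scal (inverse f) (trunc n (matvec n Q x))"
    have "dq n psi (trunc n (matvec n Q x)) = dq n psi (matvec n Q x)" by (rule dq_cong) simp
    then have "dq n psi (trunc n (matvec n Q x)) = f * dq n phi x" using Q by simp
    then have "?q' ?y = dq n phi x" using f(2) by (simp add: dq_scal power2_eq_square)
    moreover have "?y \<in> fvec F n"
      using trunc_in_fvec[OF vec_in_matvec[OF F PQ(2) x]] f(1)
      by (intro fvec_closed(4)[OF F]) (auto simp: subfieldD[OF F])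
    ultimately show "?y \<in> fvec F n \<and> ?q' ?y = dq n phi x" by blast
  qed
  then obtain M' where M': "invertible_over F n M'" "\<And>x. x \<in> fvec F n \<Longrightarrow> dq n phi (matvec n M' x) = ?q' x"
    by blast
  have "qf_eval n phi (matvec n M' x) = qf_eval n (\<lambda>i j. f * psi i j) x" if "vec_in F n x" for x
  proof -
    have "dq n psi (trunc n x) = dq n psi x" by (rule dq_cong) simp
    then show ?thesis
      using M'(2)[OF trunc_in_fvec[OF that]] unfolding phi psi matvec_trunc by simp
  qed
  then show ?thesis
    unfolding qf_similar_def qf_iso_def using f c(2) M'(1) by blast
qed

text \<open>Evaluated at unit vectors, the isometry is an equality of Gram matrices, which is
  independent of the field of the vectors.\<close>

lemma bf_similar_extend:
  fixes K :: "'a::field set"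
  assumes K: "is_subfield K" and sim: "bf_similar K m phi n psi"
  shows "bf_similar UNIV m phi n psi"
proof -
  obtain t M where t: "t \<noteq> 0" "m = n" and M: "invertible_over K n M"
    and ev: "\<And>x y. vec_in K n x \<Longrightarrow> vec_in K n y \<Longrightarrow>
      bf_eval n phi (matvec n M x) (matvec n M y) = bf_eval n (\<lambda>i j. t * psi i j) x y"
    using sim unfolding bf_similar_def bf_iso_def by blast
  let ?H = "\<lambda>i j. \<Sum>k<n. (\<Sum>l<n. phi l k * M l i) * M k j"
  have H: "bf_eval n phi (matvec n M x) (matvec n M y) = bf_eval n ?H x y" for x y
    by (subst bf_eval_matvec_left, subst bf_eval_matvec_right, rule refl)
  have "?H i j = t * psi i j" if "i < n" "j < n" for i j
  proof -
    have "vec_in K n (unitv k)" for k by (auto simp: vec_in_def unitv_def subfieldD[OF K])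
    from ev[OF this this, of i j] show ?thesis unfolding H bf_eval_unitv[OF that] .
  qed
  then have "bf_eval n phi (matvec n M x) (matvec n M y) = bf_eval n (\<lambda>i j. t * psi i j) x y" for x y
    unfolding H by (rule bf_eval_matrix_cong)
  then show ?thesis
    unfolding bf_similar_def bf_iso_def using t invertible_over_UNIV[OF M] by blast
qed

lemma bf_similar_descend:
  fixes F :: "'a::field set"
  assumes char: "CHAR('a) = 2" and sep: "separable_algebraic_ext F"
    and ns: "nonsingular_symmetric_bf F m phi" "nonsingular_symmetric_bf F n psi"
    and sim: "bf_similar UNIV m phi n psi"
  shows "bf_similar F m phi n psi"
proof -
  have F: "is_subfield F" using sep by (simp add: separable_algebraic_ext_def)
  obtain c M where c: "c \<noteq> 0" "m = n" and M: "invertible_over UNIV n M"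
    and ev: "\<And>x y. bf_eval n phi (matvec n M x) (matvec n M y) = c * bf_eval n psi x y"
    using sim unfolding bf_similar_def bf_iso_def vec_in_def bf_eval_factor by blast
  note ns' = ns(1)[unfolded c(2)] ns(2)
  have mats: "mat_in F n phi" "mat_in F n psi"
    and sym: "\<forall>i<n. \<forall>j<n. phi i j = phi j i" "\<forall>i<n. \<forall>j<n. psi i j = psi j i"
    using ns' unfolding nonsingular_symmetric_bf_def by blast+
  note norm = bf_eval_diag[OF char sym(1)] bf_eval_diag[OF char sym(2)]
  obtain N where N: "\<forall>i<n. \<forall>k<n. (\<Sum>j<n. M i j * N j k) = (if i = k then 1 else 0)"
    using M unfolding invertible_over_def by blast
  \<comment> \<open>The unit vector in the second argument is \<open>M\<close> applied to column
    \<open>j\<close> of \<open>N\<close>, so the similarity itself applies.\<close>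
  have adj: "(\<Sum>k<n. phi k j * M k i) = (\<Sum>k<n. psi i k * (c * N k j))" if ij: "i < n" "j < n" for i j
  proof -
    have "(\<Sum>k<n. phi k j * M k i) = bf_eval n phi (matvec n M (unitv i)) (unitv j)"
      by (simp add: bf_eval_unitv_right[OF ij(2)] matvec_unitv[OF ij(1)])
    also have "\<dots> = bf_eval n phi (matvec n M (unitv i)) (matvec n M (matvec n N (unitv j)))"
      using matvec_inverse[OF N] by (intro bf_eval_cong) auto
    also have "\<dots> = c * (\<Sum>k<n. psi i k * N k j)"
      unfolding ev by (simp add: bf_eval_unitv_left[OF ij(1)] matvec_unitv[OF ij(2)])
    finally show ?thesis by (simp add: sum_distrib_left ac_simps)
  qed
  have diag: "\<forall>i<n. phi i i \<in> F \<and> psi i i \<in> F" using mats unfolding mat_in_def by blast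
  have dq_ev: "dq n phi (matvec n M x) = c * dq n psi x" for x using ev[of x x] unfolding norm .
  from similarity_descends[OF char sep diag c(1) N dq_ev]
  obtain f P Q where f: "f \<in> F" "f \<noteq> 0" and PQ: "mat_in F n P" "mat_in F n Q"
    and P': "\<forall>j<n. dq n phi (\<lambda>i. P i j) = f * psi j j"
    and Q': "\<forall>j<n. dq n psi (\<lambda>i. Q i j) = f * phi j j"
    and adj': "mat_in F n phi \<longrightarrow> mat_in F n psi \<longrightarrow>
      (\<forall>i<n. \<forall>j<n. (\<Sum>k<n. phi k j * M k i) = (\<Sum>k<n. psi i k * (c * N k j))) \<longrightarrow>
      (\<forall>i<n. \<forall>j<n. (\<Sum>k<n. phi k j * P k i) = (\<Sum>k<n. psi i k * Q k j))" by (elim exE conjE)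
  have P: "dq n phi (matvec n P x) = f * dq n psi x" for x
    using P' by (intro dq_matvec_columns[OF char]) auto
  have Q: "dq n psi (matvec n Q x) = f * dq n phi x" for x
    using Q' by (intro dq_matvec_columns[OF char]) auto
  have PQadj: "(\<Sum>k<n. phi k j * P k i) = (\<Sum>k<n. psi i k * Q k j)" if "i < n" "j < n" for i j
    using adj' mats adj that by simp
  \<comment> \<open>Absorbing \<open>f\<close> into the form turns the similarity into an isometry;
    \<open>inverse f\<close> in \<open>?N\<close> makes up for it in the norm and in the adjoint
    relation.\<close>
  let ?C = "\<lambda>i j. f * psi i j"
  let ?P = "\<lambda>x. trunc n (matvec n P x)"
  let ?N = "\<lambda>x. scal (inverse f) (trunc n (matvec n Q x))"
  have Cns: "nonsingular_symmetric_bf F n ?C"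
    using ns'(2) f unfolding nonsingular_symmetric_bf_def bf_eval_factor mat_in_def
    by (auto simp: subfieldD[OF F])
  have C_norm: "bf_eval n ?C x x = f * dq n psi x" for x unfolding bf_eval_factor norm ..
  have tr: "dq n a (trunc n x) = dq n a x" for a x by (rule dq_cong) simp
  interpret adjoint_pair F n phi ?C ?P ?N
  proof unfold_locales
    show "is_subfield F" "CHAR('a) = 2" "nonsingular_symmetric_bf F n phi" "nonsingular_symmetric_bf F n ?C"
      using F char ns'(1) Cns by auto
    show "?P (x + y) = ?P x + ?P y" for x y
      by (simp add: trunc_def matvec_def fun_eq_iff distrib_left sum.distrib)
    show "?P (scal t x) = scal t (?P x)" for t x
      by (simp add: trunc_def matvec_def fun_eq_iff sum_distrib_left ac_simps)
    fix x assume x: "x \<in> fvec F n"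
    show "?P x \<in> fvec F n" using trunc_in_fvec[OF vec_in_matvec[OF F PQ(1) x]] .
    show "?N x \<in> fvec F n"
      using trunc_in_fvec[OF vec_in_matvec[OF F PQ(2) x]] f(1)
      by (intro fvec_closed(4)[OF F]) (auto simp: subfieldD[OF F])
    show "bf_eval n phi (?P x) (?P x) = bf_eval n ?C x x"
      unfolding C_norm norm tr by (rule P)
    show "bf_eval n ?C (?N x) (?N x) = bf_eval n phi x x"
      unfolding C_norm norm tr dq_scal Q
      using f(2) by (simp add: power2_eq_square)
    fix y assume "y \<in> fvec F n"
    have "bf_eval n phi (?P x) y = bf_eval n phi (matvec n P x) y" by (rule bf_eval_cong) auto
    also have "\<dots> = bf_eval n psi x (matvec n Q y)"
      unfolding bf_eval_matvec_left bf_eval_matvec_right using PQadj by (rule bf_eval_matrix_cong)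
    also have "\<dots> = bf_eval n psi x (trunc n (matvec n Q y))" by (rule bf_eval_cong) auto
    finally show "bf_eval n phi (?P x) y = bf_eval n ?C x (?N y)"
      using f(2) by (simp add: bf_eval_factor bf_eval_scal_right)
  qed
  obtain M' where M': "invertible_over F n M'"
    "\<And>x y. x \<in> fvec F n \<Longrightarrow> y \<in> fvec F n \<Longrightarrow> bf_eval n phi (matvec n M' x) (matvec n M' y) = bf_eval n ?C x y"
    using isometry_exists by blast
  have "bf_eval n phi (matvec n M' x) (matvec n M' y) = bf_eval n ?C x y"
    if "vec_in F n x" "vec_in F n y" for x y
  proof -
    have "bf_eval n ?C (trunc n x) (trunc n y) = bf_eval n ?C x y" by (rule bf_eval_cong) auto
    then show ?thesis using M'(2)[OF that[THEN trunc_in_fvec]] unfolding matvec_trunc by simp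
  qed
  then show ?thesis
    unfolding bf_similar_def bf_iso_def using f c(2) M'(1) by blast
qed

theorem theorem5p2:
  fixes F :: "'a::field set" and phi psi :: "nat \<Rightarrow> nat \<Rightarrow> 'a" and m n :: nat
  assumes "CHAR('a) = 2"
    and "separable_algebraic_ext F"
  shows "(totally_singular_qf F m phi \<and> totally_singular_qf F n psi \<longrightarrow>
            (qf_similar F m phi n psi \<longleftrightarrow> qf_similar UNIV m phi n psi))
       \<and> (nonsingular_symmetric_bf F m phi \<and> nonsingular_symmetric_bf F n psi \<longrightarrow>
            (bf_similar F m phi n psi \<longleftrightarrow> bf_similar UNIV m phi n psi))"
proof -
  have "is_subfield F" using assms(2) by (simp add: separable_algebraic_ext_def)
  then show ?thesis
    using qf_similar_extend[OF assms(1)] qf_similar_descend[OF assms] bf_similar_extend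
      bf_similar_descend[OF assms] by blast
qed

end
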